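(* Let $p$ be a prime, let $K/F$ be a finite abelian Galois extension of fields (of any characteristic) whose Galois group $G=\langle\sigma_1\rangle\times\cdots\times\langle\sigma_r\rangle$, $r\ge2$, is a (noncyclic) $p$-group, and let $\Delta=(K/F,z_\sigma,u,b)$ be an abelian crossed product. Let $E/F$ be any finite field extension of degree prime to $p$, let $KE$ be the composite field, and identify $\mathrm{Gal}(KE/E)$ with $G$ by restriction. If $u$ is not strongly degenerate in $K/F$, then $u$, viewed as a matrix with entries in $(KE)^*$, is not strongly degenerate in $KE/E$. If $u$ is not degenerate in $K/F$, then $u$, viewed as a matrix with entries in $(KE)^*$, is not degenerate in $KE/E$.
   Context: Abelian crossed product: let $G=\langle\sigma_1\rangle\times\cdots\times\langle\sigma_r\rangle$ be a finite abelian group with basis $\sigma=\{\sigma_1,\ldots,\sigma_r\}$ (nontrivial elements), $n_i=|\sigma_i|$, and $K/F$ a $G$-Galois extension of fields. $\Delta=(K/F,z_\sigma,u,b)$ denotes a central simple $F$-algebra of degree $[K:F]$ containing $K$, together with units $z_1,\ldots,z_r\in\Delta$ such that $z_i k z_i^{-1}=\sigma_i(k)$ for $k\in K$; here $u=(u_{ij})\in M_r(K^* )$ (all entries in $K^*$) with $u_{ij}=z_iz_jz_i^{-1}z_j^{-1}$, and $b=\{b_i\}_{i=1}^r$ with $b_i=z_i^{n_i}\in K^*$. Thus $\Delta=\bigoplus_{0\le m_i<n_i}K\,z_1^{m_1}\cdots z_r^{m_r}$. Notation: for $\overline m,\overline n\in\mathbb{N}^r$ put $\sigma^{\overline m}=\sigma_1^{m_1}\cdots\sigma_r^{m_r}$,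 $z^{\overline m}=z_1^{m_1}\cdots z_r^{m_r}$, $u_{\overline m,\overline n}=z^{\overline m}z^{\overline n}(z^{\overline m})^{-1}(z^{\overline n})^{-1}\in K^*$, and $u_{i,\overline m}=u_{\overline e_i,\overline m}$ with $\overline e_i$ the $i$-th standard basis vector. These depend only on $u$ and the Galois action. Degeneracy notions (for $G$ noncyclic), for a $G$-Galois extension $L/M$ (here $K/F$ or $KE/E$) and $u$ with entries in $L^*$: $u$ is degenerate in $L/M$ if there are $\overline m,\overline n\in\mathbb{N}^r$ and $a,c\in L^*$ such that $\langle\sigma^{\overline m},\sigma^{\overline n}\rangle$ is not cyclic and $u_{\overline m,\overline n}=\sigma^{\overline m}(a)a^{-1}\sigma^{\overline n}(c)c^{-1}$. It is strongly degenerate in $L/M$ if there exist $\overline m\in\mathbb{N}^r$ with $\sigma^{\overline m}\in G$ of prime order and $l,y_1,\ldots,y_r\in L^*$ such that $u_{i,\overline m}=\frac{\sigma^{\overline m}(y_i)}{y_i}\cdot\frac{l}{\sigma_i(l)}$ for all $1\le i\le r$. *)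

theory Defs
  imports
    "Jordan_Normal_Form.Ring_Hom_Matrix"
    "HOL-Algebra.Algebra"
begin

text \<open>
  Every field is a type of class \<^class>\<open>field\<close>; an extension \<open>K/F\<close> is given by its inclusion map
  \<open>i :: 'f \<Rightarrow> 'k\<close>, a \<^const>\<open>field_hom\<close>. Likewise an \<open>F\<close>-algebra is a type of class \<^class>\<open>ring_1\<close>
  together with its structure map from \<open>F\<close>.
\<close>

definition finite_dim_over :: "('f::field \<Rightarrow> 'a::ring_1) \<Rightarrow> bool" where
  "finite_dim_over i \<longleftrightarrow> (\<exists>B. finite B \<and> module.span (\<lambda>c x. i c * x) B = UNIV)"

definition dim_over :: "('f::field \<Rightarrow> 'a::ring_1) \<Rightarrow> nat" where
  "dim_over i = vector_space.dim (\<lambda>c x. i c * x) UNIV"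

definition finite_extension :: "('f::field \<Rightarrow> 'k::field) \<Rightarrow> bool" where
  "finite_extension i \<longleftrightarrow> field_hom i \<and> finite_dim_over i"

definition gal :: "('f::field \<Rightarrow> 'k::field) \<Rightarrow> ('k \<Rightarrow> 'k) monoid" where
  "gal i = \<lparr>carrier = {\<tau>. field_isom \<tau> \<and> \<tau> \<circ> i = i}, monoid.mult = (\<circ>), one = id\<rparr>"

definition galois_extension :: "('f::field \<Rightarrow> 'k::field) \<Rightarrow> bool" where
  "galois_extension i \<longleftrightarrow>
     finite_extension i \<and> {x. \<forall>\<tau>\<in>carrier (gal i). \<tau> x = x} = range i"

definition is_subfield :: "'a::field set \<Rightarrow> bool" where
  "is_subfield S \<longleftrightarrow> 0 \<in> S \<and> 1 \<in> S \<and>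
     (\<forall>x\<in>S. \<forall>y\<in>S. x - y \<in> S \<and> x * y \<in> S) \<and> (\<forall>x\<in>S. inverse x \<in> S)"

text \<open>\<open>composite_field iK iE jK jE\<close>: the codomain of \<open>jK\<close> and \<open>jE\<close> is a composite \<open>KE\<close> over \<open>F\<close>
  of the extensions \<open>iK : F \<rightarrow> K\<close> and \<open>iE : F \<rightarrow> E\<close>.\<close>

definition composite_field ::
    "('f::field \<Rightarrow> 'k::field) \<Rightarrow> ('f \<Rightarrow> 'e::field) \<Rightarrow> ('k \<Rightarrow> 'l::field) \<Rightarrow> ('e \<Rightarrow> 'l) \<Rightarrow> bool" where
  "composite_field iK iE jK jE \<longleftrightarrow>
     field_hom jK \<and> field_hom jE \<and> jK \<circ> iK = jE \<circ> iE \<and>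
     is_subfield hull (range jK \<union> range jE) = UNIV"

text \<open>The automorphism of \<open>KE/E\<close> whose restriction to \<open>K\<close> is \<open>\<tau>\<close>.\<close>

definition gal_lift :: "('k::field \<Rightarrow> 'l::field) \<Rightarrow> ('e::field \<Rightarrow> 'l) \<Rightarrow> ('k \<Rightarrow> 'k) \<Rightarrow> ('l \<Rightarrow> 'l)" where
  "gal_lift jK jE \<tau> = (THE \<rho>. \<rho> \<in> carrier (gal jE) \<and> \<rho> \<circ> jK = jK \<circ> \<tau>)"

text \<open>A finite family \<open>x\<^sub>0, \<dots>, x\<^bsub>r-1\<^esub>\<close> of nontrivial elements of an abelian group \<open>G\<close> that is the
  internal direct product of the cyclic subgroups they generate.\<close>

definition group_basis :: "('a, 'b) monoid_scheme \<Rightarrow> nat \<Rightarrow> (nat \<Rightarrow> 'a) \<Rightarrow> bool" where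
  "group_basis G r x \<longleftrightarrow>
     comm_group G \<and> (\<forall>i<r. x i \<in> carrier G \<and> x i \<noteq> \<one>\<^bsub>G\<^esub>) \<and>
     (\<lambda>g. finprod G g {..<r}) \<in> iso (product_group {..<r} (\<lambda>i. subgroup_generated G {x i})) G"

definition two_sided_ideal :: "'d::ring_1 set \<Rightarrow> bool" where
  "two_sided_ideal I \<longleftrightarrow>
     0 \<in> I \<and> (\<forall>x\<in>I. \<forall>y\<in>I. x - y \<in> I) \<and> (\<forall>x\<in>I. \<forall>d. d * x \<in> I \<and> x * d \<in> I)"

definition central_simple_algebra :: "('f::field \<Rightarrow> 'd::ring_1) \<Rightarrow> nat \<Rightarrow> bool" where
  "central_simple_algebra i n \<longleftrightarrow>
     inj_ring_hom i \<and> range i = {x. \<forall>d. x * d = d * x} \<and>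
     (\<forall>I :: 'd set. two_sided_ideal I \<longrightarrow> I = {0} \<or> I = UNIV) \<and>
     finite_dim_over i \<and> dim_over i = n\<^sup>2"

definition ring_unit :: "'d::monoid_mult \<Rightarrow> bool" where
  "ring_unit x \<longleftrightarrow> (\<exists>y. x * y = 1 \<and> y * x = 1)"

definition ring_inv :: "'d::monoid_mult \<Rightarrow> 'd" where
  "ring_inv x = (THE y. x * y = 1 \<and> y * x = 1)"

text \<open>Multi-indices are functions \<^typ>\<open>nat \<Rightarrow> nat\<close>, of which only the values below \<open>r\<close> are used.\<close>

definition unit_index :: "nat \<Rightarrow> nat \<Rightarrow> nat" where
  "unit_index i = (\<lambda>j. if j = i then 1 else 0)"

definition aut_power :: "nat \<Rightarrow> (nat \<Rightarrow> 'k \<Rightarrow> 'k) \<Rightarrow> (nat \<Rightarrow> nat) \<Rightarrow> 'k \<Rightarrow> 'k" where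
  "aut_power r \<sigma> m = foldr (\<circ>) (map (\<lambda>i. \<sigma> i ^^ m i) [0..<r]) id"

definition ring_power :: "nat \<Rightarrow> (nat \<Rightarrow> 'd::monoid_mult) \<Rightarrow> (nat \<Rightarrow> nat) \<Rightarrow> 'd" where
  "ring_power r z m = prod_list (map (\<lambda>i. z i ^ m i) [0..<r])"

text \<open>
  The elements \<open>u\<^bsub>m,n\<^esub> = z\<^sup>m z\<^sup>n (z\<^sup>m)\<^sup>-\<^sup>1 (z\<^sup>n)\<^sup>-\<^sup>1\<close> are needed for \<open>K/F\<close> as well as for \<open>KE/E\<close>. They
  are therefore computed from \<open>u\<close> and the Galois action alone, by writing \<open>z\<^sup>m\<close> and \<open>z\<^sup>n\<close> as words in
  the \<open>z\<^sub>i\<close> and moving the letters past each other with \<open>z\<^sub>i z\<^sub>j = u\<^sub>i\<^sub>j z\<^sub>j z\<^sub>i\<close> and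
  \<open>z\<^sub>i k = \<sigma>\<^sub>i(k) z\<^sub>i\<close>; lemma \<open>u_multi_eq\<close> below shows that this is the commutator of \<open>z\<^sup>m\<close> and \<open>z\<^sup>n\<close>.
\<close>

primrec u_letter_word ::
    "(nat \<Rightarrow> 'k \<Rightarrow> 'k) \<Rightarrow> (nat \<Rightarrow> nat \<Rightarrow> 'k::field) \<Rightarrow> nat \<Rightarrow> nat list \<Rightarrow> 'k" where
  "u_letter_word \<sigma> u i [] = 1"
| "u_letter_word \<sigma> u i (j # v) = u i j * \<sigma> j (u_letter_word \<sigma> u i v)"

primrec u_word ::
    "(nat \<Rightarrow> 'k \<Rightarrow> 'k) \<Rightarrow> (nat \<Rightarrow> nat \<Rightarrow> 'k::field) \<Rightarrow> nat list \<Rightarrow> nat list \<Rightarrow> 'k" where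
  "u_word \<sigma> u [] v = 1"
| "u_word \<sigma> u (i # w) v = \<sigma> i (u_word \<sigma> u w v) * u_letter_word \<sigma> u i v"

definition index_word :: "nat \<Rightarrow> (nat \<Rightarrow> nat) \<Rightarrow> nat list" where
  "index_word r m = concat (map (\<lambda>i. replicate (m i) i) [0..<r])"

definition u_multi ::
    "nat \<Rightarrow> (nat \<Rightarrow> 'k \<Rightarrow> 'k) \<Rightarrow> (nat \<Rightarrow> nat \<Rightarrow> 'k::field) \<Rightarrow> (nat \<Rightarrow> nat) \<Rightarrow> (nat \<Rightarrow> nat) \<Rightarrow> 'k" where
  "u_multi r \<sigma> u m n = u_word \<sigma> u (index_word r m) (index_word r n)"

text \<open>\<open>\<Delta> = (K/F, z\<^sub>\<sigma>, u, b)\<close>, where \<open>iK : F \<rightarrow> K\<close> and \<open>\<kappa> : K \<rightarrow> \<Delta>\<close> are the inclusions.\<close>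

locale abelian_crossed_product =
  fixes iK :: "'f::field \<Rightarrow> 'k::field"
    and \<kappa> :: "'k \<Rightarrow> 'd::ring_1"
    and r :: nat
    and \<sigma> :: "nat \<Rightarrow> 'k \<Rightarrow> 'k"
    and z :: "nat \<Rightarrow> 'd"
    and u :: "nat \<Rightarrow> nat \<Rightarrow> 'k"
    and b :: "nat \<Rightarrow> 'k"
  assumes galois: "galois_extension iK"
    and basis: "group_basis (gal iK) r \<sigma>"
    and central_simple: "central_simple_algebra (\<kappa> \<circ> iK) (dim_over iK)"
    and embedding: "inj_ring_hom \<kappa>"
    and z_unit: "\<And>i. i < r \<Longrightarrow> ring_unit (z i)"
    and z_conj: "\<And>i k. i < r \<Longrightarrow> z i * \<kappa> k * ring_inv (z i) = \<kappa> (\<sigma> i k)"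
    and u_nonzero: "\<And>i j. i < r \<Longrightarrow> j < r \<Longrightarrow> u i j \<noteq> 0"
    and u_eq: "\<And>i j. i < r \<Longrightarrow> j < r \<Longrightarrow>
                 \<kappa> (u i j) = z i * z j * ring_inv (z i) * ring_inv (z j)"
    and b_nonzero: "\<And>i. i < r \<Longrightarrow> b i \<noteq> 0"
    and b_eq: "\<And>i. i < r \<Longrightarrow> \<kappa> (b i) = z i ^ group.ord (gal iK) (\<sigma> i)"

lemma ring_inv_unique:
  assumes "x * y = 1" "y * x = (1::'d::monoid_mult)"
  shows "ring_inv x = y"
  unfolding ring_inv_def using assms by (intro the_equality) (auto, metis mult.assoc mult_1_left mult_1_right)

lemma ring_unit_inv:
  assumes "ring_unit x"
  shows "x * ring_inv x = 1" "ring_inv x * x = 1"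
  using assms ring_inv_unique[of x] unfolding ring_unit_def by auto

lemma ring_unit_prod_list: "(\<And>x. x \<in> set xs \<Longrightarrow> ring_unit x) \<Longrightarrow> ring_unit (prod_list xs)"
proof (induction xs)
  case Nil
  then show ?case by (auto simp: ring_unit_def)
next
  case (Cons x xs)
  obtain y where y: "x * y = 1" "y * x = 1" using Cons.prems[of x] by (auto simp: ring_unit_def)
  obtain v where v: "prod_list xs * v = 1" "v * prod_list xs = 1"
    using Cons by (auto simp: ring_unit_def)
  have "x * (prod_list xs * (v * y)) = 1" "v * y * (x * prod_list xs) = 1"
    using y v by (metis mult.assoc mult_1_left)+
  then show ?case unfolding ring_unit_def by (auto simp: mult.assoc)
qed

lemma ring_power_word: "ring_power r z m = prod_list (map z (index_word r m))"
proof -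
  have "prod_list (map z (concat (map (\<lambda>i. replicate (m i) i) xs)))
      = prod_list (map (\<lambda>i. z i ^ m i) xs)" for xs
    by (induction xs) (auto simp: map_replicate)
  then show ?thesis by (simp add: ring_power_def index_word_def)
qed

lemma set_index_word: "set (index_word r m) \<subseteq> {..<r}"
  by (auto simp: index_word_def)

context abelian_crossed_product
begin

interpretation \<kappa>: inj_ring_hom \<kappa> by (rule embedding)

lemma z_move: "i < r \<Longrightarrow> z i * \<kappa> k = \<kappa> (\<sigma> i k) * z i"
  using z_conj[of i k] ring_unit_inv[OF z_unit[of i]] by (metis mult.assoc mult_1_right)

lemma z_swap:
  assumes "i < r" "j < r"
  shows "z i * z j = \<kappa> (u i j) * (z j * z i)"
proof -
  have "\<kappa> (u i j) * (z j * z i) = z i * z j * ring_inv (z i) * (ring_inv (z j) * z j) * z i"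
    by (simp only: u_eq[OF assms] mult.assoc)
  also have "\<dots> = z i * z j"
    using ring_unit_inv[OF z_unit] assms by (simp add: mult.assoc)
  finally show ?thesis by simp
qed

lemma z_letter_word:
  assumes "i < r" "set v \<subseteq> {..<r}"
  shows "z i * prod_list (map z v) = \<kappa> (u_letter_word \<sigma> u i v) * (prod_list (map z v) * z i)"
  using assms(2)
proof (induction v)
  case Nil
  then show ?case by simp
next
  case (Cons j v)
  let ?v = "prod_list (map z v)" and ?c = "u_letter_word \<sigma> u i v"
  have j: "j < r" using Cons.prems by auto
  have "z i * (z j * ?v) = \<kappa> (u i j) * (z j * (z i * ?v))"
    using z_swap[OF assms(1) j] by (metis mult.assoc)
  also have "\<dots> = \<kappa> (u i j) * ((z j * \<kappa> ?c) * (?v * z i))"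
    using Cons by (simp add: mult.assoc)
  also have "\<dots> = \<kappa> (u i j * \<sigma> j ?c) * (z j * ?v * z i)"
    by (simp add: z_move[OF j] \<kappa>.hom_mult mult.assoc)
  finally show ?case by simp
qed

lemma z_word:
  assumes "set w \<subseteq> {..<r}" "set v \<subseteq> {..<r}"
  shows "prod_list (map z w) * prod_list (map z v)
       = \<kappa> (u_word \<sigma> u w v) * (prod_list (map z v) * prod_list (map z w))"
  using assms(1)
proof (induction w)
  case Nil
  then show ?case by simp
next
  case (Cons i w)
  let ?v = "prod_list (map z v)" and ?w = "prod_list (map z w)" and ?c = "u_word \<sigma> u w v"
  have i: "i < r" using Cons.prems by auto
  have "z i * ?w * ?v = z i * \<kappa> ?c * (?v * ?w)"
    using Cons by (simp add: mult.assoc)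
  also have "\<dots> = \<kappa> (\<sigma> i ?c) * ((z i * ?v) * ?w)"
    by (simp add: z_move[OF i] mult.assoc)
  also have "\<dots> = \<kappa> (\<sigma> i ?c * u_letter_word \<sigma> u i v) * (?v * (z i * ?w))"
    by (simp add: z_letter_word[OF i assms(2)] \<kappa>.hom_mult mult.assoc)
  finally show ?case by simp
qed

lemma u_multi_eq:
  "\<kappa> (u_multi r \<sigma> u m n) =
     ring_power r z m * ring_power r z n * ring_inv (ring_power r z m) * ring_inv (ring_power r z n)"
proof -
  let ?m = "ring_power r z m" and ?n = "ring_power r z n"
  have unit: "ring_unit (ring_power r z l)" for l
    unfolding ring_power_word using set_index_word[of r l] z_unit
    by (intro ring_unit_prod_list) auto
  have "?m * ?n = \<kappa> (u_multi r \<sigma> u m n) * (?n * ?m)"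
    unfolding ring_power_word u_multi_def by (rule z_word[OF set_index_word set_index_word])
  then have "?m * ?n * ring_inv ?m * ring_inv ?n
      = \<kappa> (u_multi r \<sigma> u m n) * (?n * (?m * ring_inv ?m) * ring_inv ?n)"
    by (simp add: mult.assoc)
  then show ?thesis using ring_unit_inv[OF unit] by simp
qed

end

text \<open>In both definitions \<open>i : M \<rightarrow> L\<close> is the extension, \<open>\<sigma>\<close> the basis of its Galois group, and \<open>u\<close> a
  matrix with entries in \<open>L\<^sup>*\<close>.\<close>

definition degenerate ::
    "('m::field \<Rightarrow> 'l::field) \<Rightarrow> nat \<Rightarrow> (nat \<Rightarrow> 'l \<Rightarrow> 'l) \<Rightarrow> (nat \<Rightarrow> nat \<Rightarrow> 'l) \<Rightarrow> bool" where
  "degenerate i r \<sigma> u \<longleftrightarrow>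
     (\<exists>m n a c. a \<noteq> 0 \<and> c \<noteq> 0 \<and>
        \<not> cyclic_group (subgroup_generated (gal i) {aut_power r \<sigma> m, aut_power r \<sigma> n}) \<and>
        u_multi r \<sigma> u m n =
          aut_power r \<sigma> m a * inverse a * aut_power r \<sigma> n c * inverse c)"

definition strongly_degenerate ::
    "('m::field \<Rightarrow> 'l::field) \<Rightarrow> nat \<Rightarrow> (nat \<Rightarrow> 'l \<Rightarrow> 'l) \<Rightarrow> (nat \<Rightarrow> nat \<Rightarrow> 'l) \<Rightarrow> bool" where
  "strongly_degenerate i r \<sigma> u \<longleftrightarrow>
     (\<exists>m l y. Factorial_Ring.prime (group.ord (gal i) (aut_power r \<sigma> m)) \<and> l \<noteq> 0 \<and> (\<forall>j<r. y j \<noteq> 0) \<and>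
        (\<forall>j<r. u_multi r \<sigma> u (unit_index j) m =
          aut_power r \<sigma> m (y j) / y j * (l / \<sigma> j l)))"

end

theory Submission
  imports Defs "Jordan_Normal_Form.Determinant"
begin

text \<open>
  Since \<open>[K:F] = |G|\<close> is a power of \<open>p\<close>, it is prime to \<open>[E:F]\<close>, so \<open>[E:F]\<close> divides \<open>[KE:K]\<close> and an
  \<open>F\<close>-basis of \<open>E\<close> is a \<open>K\<close>-basis of \<open>KE\<close>. Hence every automorphism in \<open>G\<close> lifts to \<open>KE/E\<close>, and the
  norm of \<open>KE/K\<close> commutes with the lifts, so a degeneracy relation for \<open>u\<close> over \<open>KE/E\<close> yields one
  over \<open>K/F\<close> for the power with exponent \<open>[E:F]\<close> of \<open>u\<close>. On the other hand, if \<open>\<sigma>\<^sup>n\<close> has order \<open>q\<close>, then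
  \<open>(z\<^sup>n)\<^sup>q\<close> lies in \<open>K\<^sup>*\<close>, and conjugating it by \<open>z\<^sup>m\<close> shows that the power with exponent \<open>q\<close> of
  \<open>u\<^bsub>m,n\<^esub>\<close> always has the degenerate form. As \<open>q\<close> is a power of \<open>p\<close>, the two exponents are coprime
  and the relation holds for \<open>u\<close> itself.
\<close>

section \<open>Linear algebra and the degree of a Galois extension\<close>

text \<open>Gaussian elimination, by induction on the set of equations: a nonzero coefficient serves
  as pivot and removes one equation together with one unknown.\<close>

lemma homogeneous_solution:
  fixes A :: "'t \<Rightarrow> 's \<Rightarrow> 'k::field"
  assumes "finite T" "finite S" "card T < card S"
  shows "\<exists>x. (\<exists>s\<in>S. x s \<noteq> 0) \<and> (\<forall>t\<in>T. (\<Sum>s\<in>S. A t s * x s) = 0)"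
  using assms
proof (induction T arbitrary: A S rule: finite_induct)
  case empty
  then show ?case by (intro exI[of _ "\<lambda>_. 1"]) (auto simp: card_gt_0_iff)
next
  case (insert t T)
  show ?case
  proof (cases "\<forall>s\<in>S. A t s = 0")
    case True
    have "card T < card S" using insert by simp
    from insert.IH[OF insert.prems(1) this, of A] show ?thesis using True by auto
  next
    case False
    then obtain s\<^sub>0 where s0: "s\<^sub>0 \<in> S" "A t s\<^sub>0 \<noteq> 0" by auto
    let ?S = "S - {s\<^sub>0}"
    have fin: "finite ?S" and "card T < card ?S" using insert s0 by auto
    from insert.IH[OF this, of "\<lambda>t' s. A t' s - A t' s\<^sub>0 * A t s / A t s\<^sub>0"]
    obtain x s\<^sub>1 where x: "s\<^sub>1 \<in> ?S" "x s\<^sub>1 \<noteq> 0"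
      "\<And>t'. t' \<in> T \<Longrightarrow> (\<Sum>s\<in>?S. (A t' s - A t' s\<^sub>0 * A t s / A t s\<^sub>0) * x s) = 0"
      by auto
    \<comment> \<open>The pivot coordinate is solved from equation \<open>t\<close>; the others are
      those of the reduced system.\<close>
    define y where "y = x (s\<^sub>0 := - (\<Sum>s\<in>?S. A t s * x s) / A t s\<^sub>0)"
    have split: "(\<Sum>s\<in>S. A t' s * y s) = A t' s\<^sub>0 * y s\<^sub>0 + (\<Sum>s\<in>?S. A t' s * x s)" for t'
      using s0 insert.prems(1) by (subst sum.remove[of _ s\<^sub>0]) (auto simp: y_def intro!: sum.cong)
    have "(\<Sum>s\<in>S. A t' s * y s) = 0" if "t' \<in> insert t T" for t'
    proof (cases "t' = t")
      case True
      then show ?thesis using s0 by (simp add: split) (simp add: y_def)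
    next
      case False
      then have "(\<Sum>s\<in>?S. A t' s * x s) = (\<Sum>s\<in>?S. A t' s\<^sub>0 * A t s / A t s\<^sub>0 * x s)"
        using x(3)[of t'] that by (simp add: left_diff_distrib sum_subtractf)
      also have "\<dots> = - (A t' s\<^sub>0 * y s\<^sub>0)"
        by (simp add: y_def sum_distrib_left sum_divide_distrib mult.assoc)
      finally show ?thesis by (simp add: split)
    qed
    moreover have "y s\<^sub>1 \<noteq> 0" "s\<^sub>1 \<in> S" using x by (auto simp: y_def)
    ultimately show ?thesis by blast
  qed
qed

text \<open>A solution of smallest nonempty support, normalised at \<open>s\<close>. A solution
  supported inside it and vanishing at \<open>s\<close> has strictly smaller support, hence is zero.
  Serves both Dedekind independence and Artin's bound.\<close>

lemma minimal_support:
  fixes P :: "('s \<Rightarrow> 'k::field) \<Rightarrow> bool"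
  assumes "finite S" and scale: "\<And>c x. P x \<Longrightarrow> P (\<lambda>s. c * x s)"
    and ex: "P x\<^sub>0" "s\<^sub>0 \<in> S" "x\<^sub>0 s\<^sub>0 \<noteq> 0"
  obtains x s where "P x" "s \<in> S" "x s = 1"
    "\<forall>y. P y \<longrightarrow> (\<forall>t\<in>S. x t = 0 \<longrightarrow> y t = 0) \<longrightarrow> y s = 0 \<longrightarrow> (\<forall>t\<in>S. y t = 0)"
proof -
  let ?supp = "\<lambda>x. {s\<in>S. x s \<noteq> 0}"
  let ?Q = "\<lambda>x. P x \<and> ?supp x \<noteq> {}"
  have "?Q x\<^sub>0" using ex by auto
  then obtain x where x: "?Q x" and min: "\<And>y. ?Q y \<Longrightarrow> card (?supp x) \<le> card (?supp y)"
    using ex_has_least_nat[of ?Q x\<^sub>0 "\<lambda>x. card (?supp x)"] by blast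
  then obtain s where s: "s \<in> S" "x s \<noteq> 0" by auto
  show ?thesis
  proof (rule that[of "\<lambda>t. inverse (x s) * x t" s])
    have "y t = 0" if y: "P y" "\<forall>t\<in>S. inverse (x s) * x t = 0 \<longrightarrow> y t = 0" "y s = 0" and t: "t \<in> S"
      for y t
    proof -
      have "?supp y \<subset> ?supp x" using y(2,3) s by auto
      then have "card (?supp y) < card (?supp x)" using assms(1) by (intro psubset_card_mono) auto
      then show ?thesis using min[of y] y(1) t by (auto simp: not_le[symmetric])
    qed
    then show "\<forall>y. P y \<longrightarrow> (\<forall>t\<in>S. inverse (x s) * x t = 0 \<longrightarrow> y t = 0) \<longrightarrow> y s = 0 \<longrightarrow> (\<forall>t\<in>S. y t = 0)"
      by blast
  qed (use x s scale in auto)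
qed

text \<open>Dedekind's argument on a shortest relation: replacing \<open>l\<close> by
  \<open>l * k\<close> and subtracting a multiple of the relation removes the term of
  \<open>\<tau>\<close>, so the new relation is trivial.\<close>

lemma dedekind_independence:
  fixes x :: "('k::field \<Rightarrow> 'l::field) \<Rightarrow> 'l"
  assumes "finite H" and hom: "\<And>\<sigma>. \<sigma> \<in> H \<Longrightarrow> field_hom \<sigma>"
    and zero: "\<And>k. (\<Sum>\<sigma>\<in>H. \<sigma> k * x \<sigma>) = 0" and "\<sigma> \<in> H"
  shows "x \<sigma> = 0"
proof (rule ccontr)
  let ?P = "\<lambda>x. \<forall>k. (\<Sum>\<sigma>\<in>H. \<sigma> k * x \<sigma>) = 0"
  have hom_mult: "\<sigma> (a * b) = \<sigma> a * \<sigma> b" if "\<sigma> \<in> H" for \<sigma> a b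
  proof -
    interpret field_hom \<sigma> by (rule hom[OF that])
    show ?thesis by (rule hom_mult)
  qed
  assume nz: "x \<sigma> \<noteq> 0"
  have scale: "?P (\<lambda>\<sigma>. c * y \<sigma>)" if "?P y" for c y
    using that by (simp add: mult.left_commute[of _ c] flip: sum_distrib_left)
  obtain y \<tau> where y: "?P y" "\<tau> \<in> H" "y \<tau> = 1"
    and min: "\<forall>w. ?P w \<longrightarrow> (\<forall>\<rho>\<in>H. y \<rho> = 0 \<longrightarrow> w \<rho> = 0) \<longrightarrow> w \<tau> = 0 \<longrightarrow> (\<forall>\<rho>\<in>H. w \<rho> = 0)"
    by (rule minimal_support[of H ?P x \<sigma>, OF assms(1) scale]) (use zero assms(4) nz in auto)
  have eq: "(\<rho> k - \<tau> k) * y \<rho> = 0" if "\<rho> \<in> H" for \<rho> k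
  proof -
    have "(\<Sum>\<rho>\<in>H. \<rho> l * ((\<rho> k - \<tau> k) * y \<rho>)) = 0" for l
    proof -
      have "(\<Sum>\<rho>\<in>H. \<rho> l * ((\<rho> k - \<tau> k) * y \<rho>))
          = (\<Sum>\<rho>\<in>H. \<rho> (l * k) * y \<rho>) - \<tau> k * (\<Sum>\<rho>\<in>H. \<rho> l * y \<rho>)"
        unfolding sum_distrib_left sum_subtractf[symmetric]
        by (intro sum.cong refl) (simp add: hom_mult algebra_simps)
      then show ?thesis using y(1) by simp
    qed
    then show ?thesis using min[rule_format, of "\<lambda>\<rho>. (\<rho> k - \<tau> k) * y \<rho>"] that by auto
  qed
  \<comment> \<open>Distinct maps differ at some \<open>k\<close>, so only the term of
    \<open>\<tau>\<close> is left, and evaluation at 1 rules it out.\<close>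
  have "y \<rho> = 0" if \<rho>: "\<rho> \<in> H - {\<tau>}" for \<rho>
  proof -
    obtain k where "\<rho> k \<noteq> \<tau> k" using \<rho> by (auto simp: fun_eq_iff)
    then show ?thesis using eq[of \<rho> k] \<rho> by simp
  qed
  then have "(\<Sum>\<rho>\<in>H. \<rho> 1 * y \<rho>) = \<tau> 1 * y \<tau>"
    using y(2) assms(1) by (simp add: sum.remove[of _ \<tau>])
  moreover have "\<tau> 1 = 1"
  proof -
    interpret field_hom \<tau> by (rule hom[OF y(2)])
    show ?thesis by simp
  qed
  ultimately show False using y by simp
qed

section \<open>Finite extensions and their Galois groups\<close>

lemma vector_space_field_hom:
  assumes "field_hom i"
  shows "vector_space (\<lambda>c x. i c * x)"
proof -
  interpret field_hom i by fact
  show ?thesis by unfold_locales (simp_all add: hom_distribs algebra_simps)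
qed

lemma finite_extension_basis:
  assumes "finite_extension i"
  obtains B where "finite B" "\<not> module.dependent (\<lambda>c x. i c * x) B"
    "module.span (\<lambda>c x. i c * x) B = UNIV" "card B = dim_over i"
proof -
  have hom: "field_hom i" and "finite_dim_over i" using assms by (auto simp: finite_extension_def)
  interpret V: vector_space "\<lambda>c x. i c * x" by (rule vector_space_field_hom[OF hom])
  obtain S where S: "finite S" "V.span S = UNIV"
    using \<open>finite_dim_over i\<close> by (auto simp: finite_dim_over_def)
  obtain B where B: "V.independent B" "UNIV \<subseteq> V.span B" "card B = V.dim UNIV"
    using V.basis_exists[of UNIV] by metis
  then have "finite B" using V.independent_span_bound[OF S(1), of B] S(2) by simp
  then show ?thesis using that[of B] B by (auto simp: dim_over_def)
qed

lemma gal_memD: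
  assumes "\<tau> \<in> carrier (gal i)"
  shows "field_isom \<tau>" "field_hom \<tau>" "\<tau> (i c) = i c"
  using assms by (auto simp: gal_def field_isom_def fun_eq_iff)

lemma gal_group:
  fixes i :: "'f::field \<Rightarrow> 'k::field"
  shows "group (gal i)"
proof (rule groupI)
  fix \<tau> \<rho> assume *: "\<tau> \<in> carrier (gal i)" "\<rho> \<in> carrier (gal i)"
  interpret \<tau>: field_isom \<tau> using gal_memD[OF *(1)] by simp
  interpret \<rho>: field_isom \<rho> using gal_memD[OF *(2)] by simp
  have "field_isom (\<tau> \<circ> \<rho>)"
    by unfold_locales (simp_all add: hom_distribs comp_surj \<tau>.surj \<rho>.surj del: comp_apply, simp_all add: hom_distribs)
  then show "\<tau> \<otimes>\<^bsub>gal i\<^esub> \<rho> \<in> carrier (gal i)"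
    using * by (auto simp: gal_def comp_assoc)
next
  have "field_isom (id :: 'k \<Rightarrow> 'k)" by unfold_locales auto
  then show "\<one>\<^bsub>gal i\<^esub> \<in> carrier (gal i)" by (simp add: gal_def)
next
  fix \<tau> assume *: "\<tau> \<in> carrier (gal i)"
  interpret \<tau>: field_isom \<tau> using gal_memD[OF *] by simp
  have "field_isom (inv_into UNIV \<tau>)"
    by unfold_locales (auto intro: \<tau>.bij bij_imp_bij_inv bij_is_surj)
  moreover have "inv_into UNIV \<tau> \<circ> i = i"
    using gal_memD(3)[OF *] by (auto simp: fun_eq_iff)
  moreover have "inv_into UNIV \<tau> \<circ> \<tau> = id" by (simp add: fun_eq_iff)
  ultimately show "\<exists>\<rho>\<in>carrier (gal i). \<rho> \<otimes>\<^bsub>gal i\<^esub> \<tau> = \<one>\<^bsub>gal i\<^esub>"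
    by (auto simp: gal_def)
qed (auto simp: gal_def)


lemma gal_simps:
  "\<tau> \<otimes>\<^bsub>gal i\<^esub> \<rho> = \<tau> \<circ> \<rho>" "\<one>\<^bsub>gal i\<^esub> = id"
  by (simp_all add: gal_def)

text \<open>With more independent vectors than automorphisms, the system with coefficients
  \<open>\<tau> b\<close> has a nonzero solution. A minimal one is fixed by the group, so it lies in
  the base field, and its equation for the identity contradicts independence.\<close>

lemma artin_bound:
  assumes "galois_extension i" "finite (carrier (gal i))"
    and B: "finite B" "\<not> module.dependent (\<lambda>c x. i c * x) B"
  shows "card B \<le> card (carrier (gal i))"
proof (rule ccontr)
  let ?G = "carrier (gal i)"
  have hom: "field_hom i" and fixed: "{x. \<forall>\<tau>\<in>?G. \<tau> x = x} = range i"
    using assms(1) by (auto simp: galois_extension_def finite_extension_def)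
  interpret i: field_hom i by fact
  interpret V: vector_space "\<lambda>c x. i c * x" by (rule vector_space_field_hom[OF hom])
  interpret G: group "gal i" by (rule gal_group)
  let ?P = "\<lambda>x. \<forall>\<tau>\<in>?G. (\<Sum>b\<in>B. \<tau> b * x b) = 0"
  assume "\<not> card B \<le> card ?G"
  then obtain x\<^sub>0 b\<^sub>0 where x0: "b\<^sub>0 \<in> B" "x\<^sub>0 b\<^sub>0 \<noteq> 0" "?P x\<^sub>0"
    using homogeneous_solution[of ?G B "\<lambda>\<tau> b. \<tau> b"] assms by auto
  have scale: "?P (\<lambda>b. c * y b)" if "?P y" for c y
    using that by (simp add: mult.left_commute[of _ c] flip: sum_distrib_left)
  obtain x s where x: "?P x" "s \<in> B" "x s = 1"
    and min: "\<forall>w. ?P w \<longrightarrow> (\<forall>b\<in>B. x b = 0 \<longrightarrow> w b = 0) \<longrightarrow> w s = 0 \<longrightarrow> (\<forall>b\<in>B. w b = 0)"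
    by (rule minimal_support[of B ?P x\<^sub>0 b\<^sub>0, OF B(1) scale]) (use x0 in auto)
  have "\<tau> (x b) = x b" if \<tau>: "\<tau> \<in> ?G" and b: "b \<in> B" for \<tau> b
  proof -
    interpret \<tau>: field_isom \<tau> using gal_memD[OF \<tau>] by simp
    have "(\<Sum>b\<in>B. \<rho> b * (\<tau> (x b) - x b)) = 0" if \<rho>: "\<rho> \<in> ?G" for \<rho>
    proof -
      \<comment> \<open>Applying \<open>\<tau>\<close> to the equation of \<open>?\<pi>\<close>
        gives the equation of \<open>\<rho>\<close> for the conjugated coefficients, so the
        differences \<open>\<tau> (x b) - x b\<close> solve the system again; they vanish at
        \<open>s\<close>.\<close>
      let ?\<pi> = "inv\<^bsub>gal i\<^esub> \<tau> \<otimes>\<^bsub>gal i\<^esub> \<rho>"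
      have \<pi>: "?\<pi> \<in> ?G" and "\<tau> \<otimes>\<^bsub>gal i\<^esub> ?\<pi> = \<rho>"
        using \<tau> \<rho> by (simp_all flip: G.m_assoc)
      then have "\<rho> b = \<tau> (?\<pi> b)" for b
        by (metis gal_simps(1) comp_apply)
      then have "(\<Sum>b\<in>B. \<rho> b * \<tau> (x b)) = \<tau> (\<Sum>b\<in>B. ?\<pi> b * x b)"
        by (simp add: hom_distribs)
      then show ?thesis using x(1) \<rho> \<pi> by (simp add: right_diff_distrib sum_subtractf)
    qed
    then show ?thesis
      using min[rule_format, of "\<lambda>b. \<tau> (x b) - x b" b] x(3) b by (simp del: \<tau>.f_eq_iff)
  qed
  then have "\<forall>b\<in>B. \<exists>c. x b = i c" using fixed by blast
  then obtain c where c: "\<And>b. b \<in> B \<Longrightarrow> x b = i (c b)" by metis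
  have "(\<Sum>b\<in>B. i (c b) * b) = 0"
    using x(1) G.one_closed c by (auto simp: gal_simps mult.commute)
  then have "c s = 0" using B x(2) V.independent_explicit_finite_subsets[of B] by blast
  then show False using c[OF x(2)] x(3) by simp
qed

text \<open>With fewer spanning vectors than automorphisms, a nontrivial combination of
  automorphisms vanishes on \<open>B\<close>, hence everywhere by linearity over the base field,
  against Dedekind independence.\<close>

lemma dedekind_bound:
  assumes "field_hom i" "finite (carrier (gal i))"
    and B: "finite B" "module.span (\<lambda>c x. i c * x) B = UNIV"
  shows "card (carrier (gal i)) \<le> card B"
proof (rule ccontr)
  let ?G = "carrier (gal i)"
  interpret i: field_hom i by fact
  interpret V: vector_space "\<lambda>c x. i c * x" by (rule vector_space_field_hom[OF assms(1)])
  assume "\<not> ?thesis"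
  then obtain x \<sigma> where x: "\<sigma> \<in> ?G" "x \<sigma> \<noteq> 0" "\<And>b. b \<in> B \<Longrightarrow> (\<Sum>\<tau>\<in>?G. \<tau> b * x \<tau>) = 0"
    using homogeneous_solution[of B ?G "\<lambda>b \<tau>. \<tau> b"] assms by auto
  have "(\<Sum>\<tau>\<in>?G. \<tau> k * x \<tau>) = 0" for k
  proof -
    have hom: "\<tau> 0 = 0" "\<tau> (a + b) = \<tau> a + \<tau> b" "\<tau> (i c * a) = i c * \<tau> a"
      if "\<tau> \<in> ?G" for \<tau> a b c
    proof -
      interpret \<tau>: field_hom \<tau> using gal_memD[OF that] by simp
      show "\<tau> 0 = 0" "\<tau> (a + b) = \<tau> a + \<tau> b" "\<tau> (i c * a) = i c * \<tau> a"
        using gal_memD[OF that] by (simp_all add: hom_distribs)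
    qed
    have "k \<in> V.span B" using B by simp
    then show ?thesis
    proof (induction rule: V.span_induct_alt)
      case (step c b k)
      have "(\<Sum>\<tau>\<in>?G. \<tau> (i c * b + k) * x \<tau>)
          = i c * (\<Sum>\<tau>\<in>?G. \<tau> b * x \<tau>) + (\<Sum>\<tau>\<in>?G. \<tau> k * x \<tau>)"
        by (simp add: hom distrib_right sum.distrib sum_distrib_left mult.assoc)
      then show ?case using step x(3) by simp
    qed (simp add: hom)
  qed
  then have "x \<sigma> = 0"
    using dedekind_independence[of ?G x \<sigma>] assms(2) x(1) gal_memD(2) by blast
  then show False using x(2) by simp
qed

text \<open>Converts the hypothesis on the group order into one on the degree: a basis meets Artin's
  bound as an independent set and Dedekind's bound as a spanning set.\<close>

lemma galois_dim_eq_order: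
  assumes "galois_extension i" "finite (carrier (gal i))"
  shows "dim_over i = Coset.order (gal i)"
proof -
  have "finite_extension i" "field_hom i"
    using assms(1) by (auto simp: galois_extension_def finite_extension_def)
  then obtain B where B: "finite B" "\<not> module.dependent (\<lambda>c x. i c * x) B"
    "module.span (\<lambda>c x. i c * x) B = UNIV" "card B = dim_over i"
    using finite_extension_basis by metis
  show ?thesis
    using artin_bound[OF assms B(1,2)] dedekind_bound[OF \<open>field_hom i\<close> assms(2) B(1,3)] B(4)
    by (simp add: Coset.order_def)
qed

section \<open>Composites of linearly disjoint extensions\<close>

text \<open>Passes from families to sets: two indices with equal values would give a relation with
  coefficients 1 and -1, so injectivity comes along.\<close>

lemma independent_family:
  fixes scale :: "'k::field \<Rightarrow> 'v::ab_group_add \<Rightarrow> 'v"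
  assumes "vector_space scale" "finite S"
    and indep: "\<And>w x. (\<Sum>x\<in>S. scale (w x) (f x)) = 0 \<Longrightarrow> x \<in> S \<Longrightarrow> w x = 0"
  shows "inj_on f S" "\<not> module.dependent scale (f ` S)"
proof -
  interpret V: vector_space scale by fact
  show inj: "inj_on f S"
  proof (rule inj_onI, rule ccontr)
    fix x y assume *: "x \<in> S" "y \<in> S" "f x = f y" "x \<noteq> y"
    define w where "w = (\<lambda>t. if t = x then 1 else if t = y then -1 else (0::'k))"
    have "(\<Sum>t\<in>S. scale (w t) (f t)) = (\<Sum>t\<in>{x, y}. scale (w t) (f t))"
      using assms(2) * by (intro sum.mono_neutral_right) (auto simp: w_def)
    also have "\<dots> = 0" using * by (simp add: w_def)
    finally have "w x = 0" using indep * by blast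
    then show False by (simp add: w_def)
  qed
  show "V.independent (f ` S)"
  proof (rule V.independent_if_scalars_zero)
    fix w v assume w: "(\<Sum>x\<in>f ` S. scale (w x) x) = 0" and v: "v \<in> f ` S"
    show "w v = 0" using w v indep[of "w \<circ> f"] by (auto simp: sum.reindex[OF inj])
  qed (use assms(2) in simp)
qed

lemma field_hom_comp:
  assumes "field_hom i" "field_hom j"
  shows "field_hom (j \<circ> i)"
proof -
  interpret i: field_hom i by fact
  interpret j: field_hom j by fact
  show ?thesis
    by unfold_locales (simp_all add: i.hom_add j.hom_add i.hom_mult j.hom_mult)
qed

text \<open>Tower law: products of a basis of the lower extension with a basis of the upper one form
  a basis.\<close>

lemma dim_over_comp:
  assumes "finite_extension i" "finite_extension j"
  shows "dim_over (j \<circ> i) = dim_over i * dim_over j"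
proof -
  have hom: "field_hom i" "field_hom j" using assms by (auto simp: finite_extension_def)
  note ji = field_hom_comp[OF hom]
  interpret j: field_hom j by (rule hom)
  interpret V: vector_space "\<lambda>c x. i c * x" by (rule vector_space_field_hom[OF hom(1)])
  interpret W: vector_space "\<lambda>c x. j c * x" by (rule vector_space_field_hom[OF hom(2)])
  interpret U: vector_space "\<lambda>c x. (j \<circ> i) c * x"
    by (rule vector_space_field_hom[OF ji])
  obtain C where C: "finite C" "V.independent C" "V.span C = UNIV" "card C = dim_over i"
    using finite_extension_basis[OF assms(1)] .
  obtain B where B: "finite B" "W.independent B" "W.span B = UNIV" "card B = dim_over j"
    using finite_extension_basis[OF assms(2)] .
  let ?f = "\<lambda>(c, b). j c * b"
  have indep: "w (c\<^sub>0, b\<^sub>0) = 0"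
    if w: "(\<Sum>x\<in>C \<times> B. (j \<circ> i) (w x) * ?f x) = 0" and "c\<^sub>0 \<in> C" "b\<^sub>0 \<in> B" for w c\<^sub>0 b\<^sub>0
  proof -
    \<comment> \<open>Grouping by \<open>b\<close> lets independence over the middle field act
      first, then independence over the base field.\<close>
    have "(\<Sum>b\<in>B. j (\<Sum>c\<in>C. i (w (c, b)) * c) * b)
        = (\<Sum>b\<in>B. \<Sum>c\<in>C. (j \<circ> i) (w (c, b)) * ?f (c, b))"
      by (simp add: j.hom_sum j.hom_mult sum_distrib_right mult.assoc del: W.scale_scale)
    also have "\<dots> = (\<Sum>x\<in>C \<times> B. (j \<circ> i) (w x) * ?f x)"
      by (subst sum.swap) (simp add: sum.cartesian_product case_prod_unfold)
    finally have "(\<Sum>c\<in>C. i (w (c, b\<^sub>0)) * c) = 0"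
      using w that(3) B(1,2) W.independent_explicit_finite_subsets[of B, THEN iffD1, rule_format, OF B(2) order_refl B(1),
          of "\<lambda>b. \<Sum>c\<in>C. i (w (c, b)) * c" b\<^sub>0] by simp
    then show ?thesis
      using V.independent_explicit_finite_subsets[of C, THEN iffD1, rule_format, OF C(2) order_refl C(1),
          of "\<lambda>c. w (c, b\<^sub>0)" c\<^sub>0] that(2) by simp
  qed
  have fin: "finite (C \<times> B)" using B C by simp
  have inj: "inj_on ?f (C \<times> B)" and ind: "U.independent (?f ` (C \<times> B))"
    using independent_family[OF U.vector_space_axioms fin, of ?f] indep by auto
  have "x \<in> U.span (?f ` (C \<times> B))" for x
  proof -
    have scale: "j k * b \<in> U.span (?f ` (C \<times> B))" if "b \<in> B" for k b
    proof -
      obtain a where "k = (\<Sum>c\<in>C. i (a c) * c)" using V.span_finite[OF C(1)] C(3) by auto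
      then have "j k * b = (\<Sum>c\<in>C. (j \<circ> i) (a c) * ?f (c, b))"
        by (simp add: j.hom_sum j.hom_mult sum_distrib_right mult.assoc del: W.scale_scale)
      also have "\<dots> \<in> U.span (?f ` (C \<times> B))"
        using that by (intro U.span_sum U.span_scale U.span_base) force
      finally show ?thesis .
    qed
    obtain a where x: "x = (\<Sum>b\<in>B. j (a b) * b)" using W.span_finite[OF B(1)] B(3) by auto
    show ?thesis unfolding x by (intro U.span_sum scale)
  qed
  then have span: "U.span (?f ` (C \<times> B)) = UNIV" by auto
  have "dim_over (j \<circ> i) = card (?f ` (C \<times> B))"
    using U.dim_eq_card[OF _ ind, of UNIV] span by (simp add: dim_over_def del: comp_apply)
  also have "\<dots> = dim_over i * dim_over j"
    using B(4) C(4) by (simp add: card_image[OF inj] card_cartesian_product)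
  finally show "dim_over (j \<circ> i) = dim_over i * dim_over j" .
qed

section \<open>Linear disjointness in the composite field\<close>

lemma composite_field_swap: "composite_field iK iE jK jE \<Longrightarrow> composite_field iE iK jE jK"
  by (simp add: composite_field_def Un_commute)

text \<open>The span over K of the image of \<open>D\<close> contains both fields and is closed
  under products. Being finite-dimensional over K, it is also closed under inverses, so it is a
  subfield and hence everything.\<close>

lemma composite_field_span:
  assumes comp: "composite_field iK iE jK jE" and "field_hom iE"
    and D: "finite D" "module.span (\<lambda>c x. iE c * x) D = UNIV"
  shows "module.span (\<lambda>c x. jK c * x) (jE ` D) = UNIV"
proof -
  have hom: "field_hom jK" "field_hom jE" and comm: "\<And>c. jK (iK c) = jE (iE c)"
    and hull: "is_subfield hull (range jK \<union> range jE) = UNIV"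
    using comp by (auto simp: composite_field_def fun_eq_iff)
  interpret jK: field_hom jK by (rule hom)
  interpret jE: field_hom jE by (rule hom)
  interpret V: vector_space "\<lambda>c x. jK c * x" by (rule vector_space_field_hom[OF hom(1)])
  interpret W: vector_space "\<lambda>c x. iE c * x" by (rule vector_space_field_hom) fact
  let ?S = "V.span (jE ` D)"
  have jE: "jE y \<in> ?S" for y
  proof -
    obtain a where "y = (\<Sum>b\<in>D. iE (a b) * b)" using W.span_finite[OF D(1)] D(2) by auto
    then have "jE y = (\<Sum>b\<in>D. jK (iK (a b)) * jE b)" by (simp add: jE.hom_sum jE.hom_mult comm)
    moreover have "(\<Sum>b\<in>D. jK (iK (a b)) * jE b) \<in> ?S"
      by (intro V.span_sum V.span_scale V.span_base) simp
    ultimately show ?thesis by simp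
  qed
  have mult: "x * y \<in> ?S" if "x \<in> ?S" "y \<in> ?S" for x y
    using that(1)
  proof (induction rule: V.span_induct_alt)
    case (step c x z)
    then obtain b where b: "x = jE b" by auto
    have "jE b * y \<in> ?S" using that(2)
    proof (induction rule: V.span_induct_alt)
      case (step c' y z)
      then obtain b' where "y = jE b'" by auto
      then have "jE b * (jK c' * y + z) = jK c' * jE (b * b') + jE b * z"
        by (simp add: jE.hom_mult algebra_simps)
      then show ?case using step jE by (simp add: V.span_add V.span_scale)
    qed (simp add: V.span_zero)
    moreover have "(jK c * x + z) * y = jK c * (jE b * y) + z * y" by (simp add: b algebra_simps)
    ultimately show ?case using step by (simp add: V.span_add V.span_scale)
  qed (simp add: V.span_zero)
  have one: "1 \<in> ?S" using jE[of 1] by simp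
  have jK: "jK k \<in> ?S" for k using V.span_scale[OF one, of k] by simp
  have power: "x ^ n \<in> ?S" if "x \<in> ?S" for x n
    using that by (induction n) (auto intro: one mult)
  have inverse: "inverse x \<in> ?S" if x: "x \<in> ?S" for x
  proof (cases "x = 0")
    case False
    let ?N = "card (jE ` D)"
    \<comment> \<open>There is one more power of \<open>x\<close> than \<open>?N\<close> spanning
      vectors, so the powers satisfy a nontrivial relation over K.\<close>
    have "\<exists>w n. (\<Sum>n\<le>?N. jK (w n) * x ^ n) = 0 \<and> n \<le> ?N \<and> w n \<noteq> 0"
    proof (rule ccontr)
      assume "\<not> ?thesis"
      then have indep: "w n = 0" if "(\<Sum>n\<in>{..?N}. jK (w n) * x ^ n) = 0" "n \<in> {..?N}" for w n
        using that by auto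
      have "inj_on (\<lambda>n. x ^ n) {..?N}" "V.independent ((\<lambda>n. x ^ n) ` {..?N})"
        by (rule independent_family[OF V.vector_space_axioms finite_atMost], rule indep, assumption+)+
      then show False
        using V.independent_span_bound[of "jE ` D" "(\<lambda>n. x ^ n) ` {..?N}"] D(1)
        by (simp add: card_image image_subset_iff power[OF x])
    qed
    then obtain w where w: "(\<Sum>n\<le>?N. jK (w n) * x ^ n) = 0" and "\<exists>n. n \<le> ?N \<and> w n \<noteq> 0" by blast
    \<comment> \<open>The lowest nonzero coefficient: after division by \<open>x ^ m\<close> it is
      the constant term and the remaining terms are \<open>x * R\<close>, which exhibits the inverse
      of \<open>x\<close>.\<close>
    define m where "m = (LEAST n. n \<le> ?N \<and> w n \<noteq> 0)"
    have m: "m \<le> ?N" "w m \<noteq> 0"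
      using LeastI_ex[OF \<open>\<exists>n. n \<le> ?N \<and> w n \<noteq> 0\<close>] by (auto simp: m_def)
    have below: "w n = 0" if "n < m" for n
      using not_less_Least[of n "\<lambda>n. n \<le> ?N \<and> w n \<noteq> 0"] that m(1) by (auto simp: m_def)
    define R where "R = (\<Sum>n\<in>{m<..?N}. jK (w n) * x ^ (n - Suc m))"
    have R: "R \<in> ?S" unfolding R_def using power[OF x] by (auto intro!: V.span_sum V.span_scale)
    have "(\<Sum>n\<le>?N. jK (w n) * x ^ n) = (\<Sum>n\<in>{m..?N}. jK (w n) * x ^ n)"
      using below by (intro sum.mono_neutral_right) auto
    also have "\<dots> = jK (w m) * x ^ m + (\<Sum>n\<in>{m<..?N}. jK (w n) * x ^ n)"
      using m(1) by (simp add: sum.head)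
    also have "(\<Sum>n\<in>{m<..?N}. jK (w n) * x ^ n) = x ^ Suc m * R"
      unfolding R_def sum_distrib_left
      by (intro sum.cong refl) (simp add: mult.left_commute flip: power_add power_Suc)
    finally have "x ^ m * (jK (w m) + x * R) = 0" using w by (simp add: algebra_simps)
    then have "jK (w m) = - (x * R)" using False by (simp add: eq_neg_iff_add_eq_0)
    then have "x * (jK (inverse (w m)) * - R) = jK (inverse (w m)) * jK (w m)" by simp
    also have "\<dots> = 1" using m(2) by (simp flip: jK.hom_mult)
    finally have "x * (jK (inverse (w m)) * - R) = 1" .
    then have "inverse x = jK (inverse (w m)) * - R" by (rule inverse_unique)
    then show ?thesis using V.span_scale[OF V.span_neg[OF R]] by simp
  qed (simp add: V.span_zero)
  have "is_subfield ?S"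
    unfolding is_subfield_def using mult one inverse by (auto intro: V.span_zero V.span_diff)
  moreover have "range jK \<union> range jE \<subseteq> ?S" using jK jE by auto
  ultimately have "is_subfield hull (range jK \<union> range jE) \<subseteq> ?S" by (intro hull_minimal)
  then show ?thesis using hull by auto
qed

text \<open>The tower law along both sides gives [K:F] [KE:K] = [E:F] [KE:E], so coprimality makes
  [E:F] divide [KE:K]. A spanning set with no more elements than the dimension is
  independent.\<close>

lemma linearly_disjoint:
  assumes comp: "composite_field iK iE jK jE" and ext: "finite_extension iK" "finite_extension iE"
    and coprime: "coprime (dim_over iK) (dim_over iE)"
    and D: "finite D" "module.span (\<lambda>c x. iE c * x) D = UNIV" "card D = dim_over iE"
  shows "\<not> module.dependent (\<lambda>c x. jK c * x) (jE ` D)"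
proof -
  have hom: "field_hom iK" "field_hom iE" "field_hom jK" "field_hom jE" and comm: "jK \<circ> iK = jE \<circ> iE"
    using comp ext by (auto simp: composite_field_def finite_extension_def)
  interpret jE: field_hom jE by (rule hom)
  interpret V: vector_space "\<lambda>c x. jK c * x" by (rule vector_space_field_hom[OF hom(3)])
  have span: "V.span (jE ` D) = UNIV"
    by (rule composite_field_span[OF comp hom(2) D(1,2)])
  have jK: "finite_extension jK"
    using span D(1) hom unfolding finite_extension_def finite_dim_over_def by blast
  obtain C where "finite C" "module.span (\<lambda>c x. iK c * x) C = UNIV"
    using finite_extension_basis[OF ext(1)] by metis
  then have "finite_extension jE"
    using composite_field_span[OF composite_field_swap[OF comp] hom(1), of C] hom
    unfolding finite_extension_def finite_dim_over_def by blast
  then have "dim_over iK * dim_over jK = dim_over iE * dim_over jE"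
    using dim_over_comp jK ext comm by metis
  then have dvd: "dim_over iE dvd dim_over jK"
    using coprime by (metis coprime_dvd_mult_right_iff coprime_commute dvd_triv_left)
  obtain B where B: "finite B" "V.independent B" "V.span B = UNIV" "card B = dim_over jK"
    using finite_extension_basis[OF jK] .
  \<comment> \<open>A positive dimension is what turns divisibility into an inequality.\<close>
  have "1 \<in> V.span B" using B(3) by simp
  then have "B \<noteq> {}" by (metis V.span_empty singletonD zero_neq_one)
  then have "dim_over jK > 0" using B(1,4) by (metis card_gt_0_iff)
  then have card: "card (jE ` D) \<le> dim_over jK"
    using D(3) dvd_imp_le[OF dvd] by (simp add: card_image inj_on_def)
  interpret FV: finite_dimensional_vector_space "\<lambda>c x. jK c * x" B
    by unfold_locales (rule B)+
  have "card (jE ` D) \<le> V.dim UNIV" using card by (simp add: dim_over_def)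
  then show ?thesis
    using FV.card_le_dim_spanning[of "jE ` D" UNIV] span D(1) by simp
qed

section \<open>Lifting automorphisms to the composite field\<close>

text \<open>The family \<open>e\<close> spans E over F and its image is a basis of KE over K.
  Indexing by numbers below \<open>d\<close> makes coordinates usable as matrix entries.\<close>

locale disjoint_composite =
  fixes iK :: "'f::field \<Rightarrow> 'k::field" and iE :: "'f \<Rightarrow> 'e::field"
    and jK :: "'k \<Rightarrow> 'l::field" and jE :: "'e \<Rightarrow> 'l"
    and d :: nat and e :: "nat \<Rightarrow> 'e"
  assumes hom_jK: "field_hom jK" and hom_jE: "field_hom jE"
    and comm: "jK (iK c) = jE (iE c)"
    and expand_E: "\<exists>c. y = (\<Sum>n<d. iE (c n) * e n)"
    and expand: "\<exists>a. x = (\<Sum>n<d. jK (a n) * jE (e n))"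
    and indep: "(\<Sum>n<d. jK (a n) * jE (e n)) = 0 \<Longrightarrow> n < d \<Longrightarrow> a n = 0"
begin

sublocale jK: field_hom jK by (rule hom_jK)
sublocale jE: field_hom jE by (rule hom_jE)

text \<open>The choice is harmless: \<open>indep\<close> determines the values at all indices below
  \<open>d\<close>.\<close>

definition coords :: "'l \<Rightarrow> nat \<Rightarrow> 'k" where
  "coords x = (SOME a. x = (\<Sum>n<d. jK (a n) * jE (e n)))"

lemma coords: "(\<Sum>n<d. jK (coords x n) * jE (e n)) = x"
  using someI_ex[OF expand[of x]] by (simp add: coords_def)

lemma coordsI:
  assumes "x = (\<Sum>n<d. jK (a n) * jE (e n))" "n < d"
  shows "coords x n = a n"
proof -
  have "(\<Sum>n<d. jK (coords x n - a n) * jE (e n)) = x - x"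
    by (simp only: jK.hom_minus left_diff_distrib sum_subtractf coords flip: assms(1))
  then have "coords x n - a n = 0" by (intro indep[OF _ assms(2)]) simp
  then show ?thesis by simp
qed

text \<open>With KE identified with the tensor product of K and E over F, this is
  \<open>\<tau>\<close> tensored with the identity of E.\<close>

definition lift :: "('k \<Rightarrow> 'k) \<Rightarrow> 'l \<Rightarrow> 'l" where
  "lift \<tau> x = (\<Sum>n<d. jK (\<tau> (coords x n)) * jE (e n))"

lemma lift_expand: "lift \<tau> (\<Sum>n<d. jK (a n) * jE (e n)) = (\<Sum>n<d. jK (\<tau> (a n)) * jE (e n))"
  unfolding lift_def by (intro sum.cong refl) (simp add: coordsI[OF refl])

context
  fixes \<tau> assumes \<tau>: "\<tau> \<in> carrier (gal iK)"
begin

interpretation \<tau>: field_isom \<tau> using gal_memD(1)[OF \<tau>] .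

lemma lift_add: "lift \<tau> (x + y) = lift \<tau> x + lift \<tau> y"
proof -
  have "x + y = (\<Sum>n<d. jK (coords x n + coords y n) * jE (e n))"
    by (simp add: jK.hom_add distrib_right sum.distrib coords)
  then show ?thesis
    by (simp only: lift_expand) (simp add: lift_def \<tau>.hom_add jK.hom_add distrib_right sum.distrib)
qed

lemma lift_zero: "lift \<tau> 0 = 0"
  by (metis add.right_neutral add_left_cancel lift_add)

lemma lift_sum: "lift \<tau> (\<Sum>n\<in>A. f n) = (\<Sum>n\<in>A. lift \<tau> (f n))"
  by (induction A rule: infinite_finite_induct) (auto simp: lift_add lift_zero)

text \<open>The coefficients of \<open>y\<close> lie in F and are fixed by \<open>\<tau>\<close>.
  This frees \<open>lift\<close> from the basis, and its multiplicativity rests on it.\<close>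

lemma lift_jK_jE: "lift \<tau> (jK k * jE y) = jK (\<tau> k) * jE y"
proof -
  obtain c where y: "y = (\<Sum>n<d. iE (c n) * e n)" using expand_E by blast
  have *: "jK k * jE y = (\<Sum>n<d. jK (k * iK (c n)) * jE (e n))" for k
    by (simp add: y jE.hom_sum jE.hom_mult jK.hom_mult comm sum_distrib_left mult.assoc)
  show ?thesis
    unfolding * lift_expand by (simp add: \<tau>.hom_mult gal_memD(3)[OF \<tau>])
qed

lemma lift_jK: "lift \<tau> (jK k) = jK (\<tau> k)" and lift_jE: "lift \<tau> (jE y) = jE y"
  using lift_jK_jE[of k 1] lift_jK_jE[of 1 y] by simp_all

text \<open>Every element of KE is a sum of products of an element of K and one of E, so by
  additivity right factors of this kind suffice.\<close>

lemma lift_mult: "lift \<tau> (x * y) = lift \<tau> x * lift \<tau> y"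
proof -
  have *: "lift \<tau> (x * (jK k * jE y)) = lift \<tau> x * (jK (\<tau> k) * jE y)" for x k y
  proof -
    have "x * (jK k * jE y) = (\<Sum>n<d. jK (coords x n * k) * jE (e n * y))"
      by (subst (1) coords[of x, symmetric])
        (simp only: sum_distrib_right, simp add: jK.hom_mult jE.hom_mult mult_ac)
    then show ?thesis
      by (simp only: lift_sum lift_jK_jE lift_def[of _ x] sum_distrib_right)
        (simp add: \<tau>.hom_mult jK.hom_mult jE.hom_mult mult_ac)
  qed
  have "lift \<tau> (x * y) = lift \<tau> (\<Sum>n<d. x * (jK (coords y n) * jE (e n)))"
    by (simp only: coords flip: sum_distrib_left)
  also have "\<dots> = lift \<tau> x * lift \<tau> y"
    by (simp only: lift_sum * lift_def[of _ y] sum_distrib_left)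
  finally show ?thesis .
qed

text \<open>An automorphism over E is determined by its values on K; this makes the description in
  \<open>gal_lift\<close> definite.\<close>

lemma lift_unique:
  assumes "\<rho> \<in> carrier (gal jE)" "\<rho> \<circ> jK = jK \<circ> \<tau>"
  shows "\<rho> = lift \<tau>"
proof
  fix x
  interpret \<rho>: field_hom \<rho> using gal_memD(2)[OF assms(1)] .
  have "\<rho> (\<Sum>n<d. jK (coords x n) * jE (e n)) = lift \<tau> x"
    using assms(2) by (simp add: \<rho>.hom_sum \<rho>.hom_mult gal_memD(3)[OF assms(1)] lift_def fun_eq_iff)
  then show "\<rho> x = lift \<tau> x" by (simp only: coords)
qed

end

lemma lift_in_gal:
  assumes \<tau>: "\<tau> \<in> carrier (gal iK)"
  shows "lift \<tau> \<in> carrier (gal jE)"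
proof -
  interpret \<tau>: field_isom \<tau> using gal_memD(1)[OF \<tau>] .
  have "surj (lift \<tau>)"
  proof (rule surjI)
    fix x
    show "lift \<tau> (\<Sum>n<d. jK (inv_into UNIV \<tau> (coords x n)) * jE (e n)) = x"
      by (simp only: lift_expand \<tau>.f_inv_f coords)
  qed
  moreover have "lift \<tau> 1 = 1" using lift_jK[OF \<tau>, of 1] by simp
  ultimately have "field_isom (lift \<tau>)"
    by unfold_locales (simp_all add: lift_add[OF \<tau>] lift_zero[OF \<tau>] lift_mult[OF \<tau>])
  then show ?thesis
    using lift_jE[OF \<tau>] by (auto simp: gal_def)
qed

lemma gal_lift_eq: "\<tau> \<in> carrier (gal iK) \<Longrightarrow> gal_lift jK jE \<tau> = lift \<tau>"
  unfolding gal_lift_def using lift_in_gal lift_jK lift_unique by (intro the_equality) auto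

text \<open>The composite of two lifts fixes E and restricts to the composite on K, so uniqueness
  identifies it.\<close>

lemma lift_hom: "lift \<in> hom (gal iK) (gal jE)"
proof (rule homI)
  interpret G: group "gal iK" by (rule gal_group)
  interpret H: group "gal jE" by (rule gal_group)
  fix \<tau> \<rho> assume *: "\<tau> \<in> carrier (gal iK)" "\<rho> \<in> carrier (gal iK)"
  have "lift \<tau> \<otimes>\<^bsub>gal jE\<^esub> lift \<rho> = lift (\<tau> \<otimes>\<^bsub>gal iK\<^esub> \<rho>)"
    using * G.m_closed[OF *] H.m_closed[OF lift_in_gal lift_in_gal, OF *]
    by (intro lift_unique) (auto simp: gal_simps lift_jK)
  then show "lift (\<tau> \<otimes>\<^bsub>gal iK\<^esub> \<rho>) = lift \<tau> \<otimes>\<^bsub>gal jE\<^esub> lift \<rho>" by simp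
qed (rule lift_in_gal)

lemma lift_inj: "inj_on lift (carrier (gal iK))"
proof (rule inj_onI, rule ext)
  fix \<tau> \<rho> k assume *: "\<tau> \<in> carrier (gal iK)" "\<rho> \<in> carrier (gal iK)" "lift \<tau> = lift \<rho>"
  then have "jK (\<tau> k) = jK (\<rho> k)" by (simp flip: lift_jK)
  then show "\<tau> k = \<rho> k" by simp
qed

section \<open>The norm from KE to K\<close>

definition mult_mat :: "'l \<Rightarrow> 'k mat" where
  "mult_mat x = mat d d (\<lambda>(m, n). coords (x * jE (e n)) m)"

text \<open>The field norm of KE/K, by way of the regular representation.\<close>

definition norm_K :: "'l \<Rightarrow> 'k" where
  "norm_K x = det (mult_mat x)"

lemma mult_mat_carrier [simp]: "mult_mat x \<in> carrier_mat d d"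
  by (simp add: mult_mat_def)

lemma mult_matI:
  assumes "M \<in> carrier_mat d d"
    and "\<And>n. n < d \<Longrightarrow> x * jE (e n) = (\<Sum>m<d. jK (M $$ (m, n)) * jE (e m))"
  shows "mult_mat x = M"
  using assms(1) by (intro eq_matI) (auto simp: mult_mat_def intro!: coordsI[OF assms(2)])

lemma mult_mat: "n < d \<Longrightarrow> x * jE (e n) = (\<Sum>m<d. jK (mult_mat x $$ (m, n)) * jE (e m))"
  by (simp add: mult_mat_def coords)

lemma norm_mult: "norm_K (x * y) = norm_K x * norm_K y"
proof -
  have "mult_mat (x * y) = mult_mat x * mult_mat y"
  proof (rule mult_matI)
    fix n assume n: "n < d"
    have "x * y * jE (e n) = x * (y * jE (e n))" by (rule mult.assoc)
    also have "\<dots> = (\<Sum>l<d. jK (mult_mat y $$ (l, n)) * (x * jE (e l)))"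
      by (simp only: mult_mat[OF n, of y] sum_distrib_left mult.left_commute[of x])
    also have "\<dots> = (\<Sum>l<d. \<Sum>m<d. jK (mult_mat x $$ (m, l) * mult_mat y $$ (l, n)) * jE (e m))"
      by (intro sum.cong refl) (simp add: mult_mat jK.hom_mult sum_distrib_left mult_ac)
    also have "\<dots> = (\<Sum>m<d. jK (\<Sum>l<d. mult_mat x $$ (m, l) * mult_mat y $$ (l, n)) * jE (e m))"
      by (subst sum.swap) (simp only: jK.hom_sum sum_distrib_right)
    also have "\<dots> = (\<Sum>m<d. jK ((mult_mat x * mult_mat y) $$ (m, n)) * jE (e m))"
      using n by (intro sum.cong refl arg_cong2[of _ _ _ _ "(*)"] arg_cong[of _ _ jK])
        (simp add: times_mat_def scalar_prod_def mult_mat_def atLeast0LessThan)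
    finally show "x * y * jE (e n) = (\<Sum>m<d. jK ((mult_mat x * mult_mat y) $$ (m, n)) * jE (e m))" .
  qed (rule mult_carrier_mat[OF mult_mat_carrier mult_mat_carrier])
  then show ?thesis unfolding norm_K_def by (simp add: det_mult[of _ d])
qed

text \<open>Elements of K act by scalar matrices, whose size \<open>d\<close> becomes the
  exponent.\<close>

lemma norm_jK: "norm_K (jK k) = k ^ d"
proof -
  have "mult_mat (jK k) = k \<cdot>\<^sub>m 1\<^sub>m d"
  proof (rule mult_matI)
    fix n assume n: "n < d"
    have "(\<Sum>m<d. jK ((k \<cdot>\<^sub>m 1\<^sub>m d) $$ (m, n)) * jE (e m)) = (\<Sum>m<d. if m = n then jK k * jE (e m) else 0)"
      using n by (intro sum.cong refl) auto
    then show "jK k * jE (e n) = (\<Sum>m<d. jK ((k \<cdot>\<^sub>m 1\<^sub>m d) $$ (m, n)) * jE (e m))"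
      using n by simp
  qed simp
  then show ?thesis by (simp add: norm_K_def)
qed

lemma norm_nonzero: "x \<noteq> 0 \<Longrightarrow> norm_K x \<noteq> 0"
  using norm_mult[of x "inverse x"] norm_jK[of 1] by auto

text \<open>Lifts fix the basis vectors, which come from E, so the matrix of the lifted element
  arises by applying \<open>\<tau>\<close> entrywise, and determinants commute with field
  homomorphisms.\<close>

lemma norm_lift:
  assumes \<tau>: "\<tau> \<in> carrier (gal iK)"
  shows "norm_K (lift \<tau> x) = \<tau> (norm_K x)"
proof -
  interpret \<tau>: field_isom \<tau> using gal_memD(1)[OF \<tau>] .
  have "mult_mat (lift \<tau> x) = map_mat \<tau> (mult_mat x)"
  proof (rule mult_matI)
    fix n assume n: "n < d"
    have "lift \<tau> x * jE (e n) = lift \<tau> (x * jE (e n))"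
      by (simp add: lift_mult[OF \<tau>] lift_jE[OF \<tau>])
    also have "\<dots> = (\<Sum>m<d. jK (\<tau> (mult_mat x $$ (m, n))) * jE (e m))"
      by (simp only: mult_mat[OF n] lift_expand)
    also have "\<dots> = (\<Sum>m<d. jK (map_mat \<tau> (mult_mat x) $$ (m, n)) * jE (e m))"
      using n by (intro sum.cong refl) (simp add: mult_mat_def)
    finally show "lift \<tau> x * jE (e n) = (\<Sum>m<d. jK (map_mat \<tau> (mult_mat x) $$ (m, n)) * jE (e m))" .
  qed simp
  then show ?thesis by (simp add: norm_K_def \<tau>.hom_det)
qed

end

lemma disjoint_compositeI:
  assumes comp: "composite_field iK iE jK jE" and ext: "finite_extension iK" "finite_extension iE"
    and coprime: "coprime (dim_over iK) (dim_over iE)"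
  obtains e where "disjoint_composite iK iE jK jE (dim_over iE) e"
proof -
  have hom: "field_hom iE" "field_hom jK" "field_hom jE" and comm: "\<And>c. jK (iK c) = jE (iE c)"
    using comp ext by (auto simp: composite_field_def finite_extension_def fun_eq_iff)
  interpret jE: field_hom jE by (rule hom)
  interpret V: vector_space "\<lambda>c x. jK c * x" by (rule vector_space_field_hom[OF hom(2)])
  interpret W: vector_space "\<lambda>c x. iE c * x" by (rule vector_space_field_hom[OF hom(1)])
  obtain D where D: "finite D" "W.independent D" "W.span D = UNIV" "card D = dim_over iE"
    using finite_extension_basis[OF ext(2)] .
  have span: "V.span (jE ` D) = UNIV" by (rule composite_field_span[OF comp hom(1) D(1,3)])
  have indep: "V.independent (jE ` D)" by (rule linearly_disjoint[OF comp ext coprime D(1,3,4)])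
  have fin: "finite (jE ` D)" using D(1) by simp
  obtain e where e: "bij_betw e {..<dim_over iE} D"
    using ex_bij_betw_nat_finite[OF D(1)] D(4) by (auto simp: atLeast0LessThan)
  have "bij_betw jE D (jE ` D)" by (simp add: inj_on_def bij_betw_def)
  from bij_betw_trans[OF e this] have jEe: "bij_betw (\<lambda>n. jE (e n)) {..<dim_over iE} (jE ` D)"
    by (simp add: comp_def)
  have "disjoint_composite iK iE jK jE (dim_over iE) e"
  proof (rule disjoint_composite.intro)
    fix y
    obtain c where "y = (\<Sum>b\<in>D. iE (c b) * b)" using W.span_finite[OF D(1)] D(3) by auto
    also have "\<dots> = (\<Sum>n<dim_over iE. iE (c (e n)) * e n)"
      by (rule sum.reindex_bij_betw[OF e, symmetric])
    finally show "\<exists>c. y = (\<Sum>n<dim_over iE. iE (c n) * e n)" by (intro exI[of _ "\<lambda>n. c (e n)"])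
  next
    fix x
    obtain c where "x = (\<Sum>b\<in>jE ` D. jK (c b) * b)" using V.span_finite[OF fin] span by auto
    also have "\<dots> = (\<Sum>n<dim_over iE. jK (c (jE (e n))) * jE (e n))"
      by (rule sum.reindex_bij_betw[OF jEe, symmetric])
    finally show "\<exists>a. x = (\<Sum>n<dim_over iE. jK (a n) * jE (e n))"
      by (intro exI[of _ "\<lambda>n. c (jE (e n))"])
  next
    fix a n assume sum: "(\<Sum>n<dim_over iE. jK (a n) * jE (e n)) = 0" and n: "n < dim_over iE"
    \<comment> \<open>Carries the coefficients over from indices to basis elements, where
      independence is stated.\<close>
    define w where "w = a \<circ> inv_into {..<dim_over iE} (\<lambda>n. jE (e n))"
    have w: "w (jE (e n)) = a n" if "n < dim_over iE" for n
      unfolding w_def using bij_betw_inv_into_left[OF jEe] that by simp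
    have "(\<Sum>b\<in>jE ` D. jK (w b) * b) = (\<Sum>n<dim_over iE. jK (w (jE (e n))) * jE (e n))"
      by (rule sum.reindex_bij_betw[OF jEe, symmetric])
    also have "\<dots> = 0" using sum by (simp add: w)
    finally have "w (jE (e n)) = 0"
      using V.independent_explicit_finite_subsets[THEN iffD1, rule_format, OF indep order_refl fin]
        bij_betw_apply[OF jEe] n by blast
    then show "a n = 0" using w n by simp
  qed (rule hom comm)+
  then show ?thesis by (rule that)
qed

section \<open>Powers in abelian crossed products\<close>

lemma gal_pow: "\<tau> [^]\<^bsub>gal i\<^esub> (n::nat) = \<tau> ^^ n"
  by (induction n) (simp_all add: gal_simps funpow_Suc_right del: funpow.simps)

lemma foldr_comp: "foldr (\<circ>) fs f = foldr (\<circ>) fs id \<circ> f"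
  by (induction fs) auto

lemma aut_power_0 [simp]: "aut_power 0 \<sigma> m = id"
  by (simp add: aut_power_def)

lemma aut_power_Suc: "aut_power (Suc r) \<sigma> m = aut_power r \<sigma> m \<circ> \<sigma> r ^^ m r"
  unfolding aut_power_def by (simp add: foldr_comp[of _ "\<sigma> r ^^ m r"])

lemma index_word_Suc: "index_word (Suc r) m = index_word r m @ replicate (m r) r"
  by (simp add: index_word_def)

text \<open>The action on K of conjugation by the word \<open>w\<close> in the \<open>z i\<close>;
  it allows induction along words.\<close>

definition word_aut :: "(nat \<Rightarrow> 'k \<Rightarrow> 'k) \<Rightarrow> nat list \<Rightarrow> 'k \<Rightarrow> 'k" where
  "word_aut \<sigma> w = foldr (\<circ>) (map \<sigma> w) id"

lemma word_aut_simps [simp]: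
  "word_aut \<sigma> [] = id" "word_aut \<sigma> (i # w) = \<sigma> i \<circ> word_aut \<sigma> w"
  by (simp_all add: word_aut_def)

lemma word_aut_append: "word_aut \<sigma> (v @ w) = word_aut \<sigma> v \<circ> word_aut \<sigma> w"
  by (induction v) (simp_all add: comp_assoc)

lemma word_aut_replicate: "word_aut \<sigma> (replicate n i) = \<sigma> i ^^ n"
  by (induction n) simp_all

lemma aut_power_word: "aut_power r \<sigma> m = word_aut \<sigma> (index_word r m)"
proof (induction r)
  case (Suc r)
  then show ?case
    by (simp add: aut_power_Suc index_word_Suc word_aut_append word_aut_replicate)
qed (simp add: index_word_def)

lemma count_index_word: "count (mset (index_word r m)) i = (if i < r then m i else 0)"
proof (induction r)
  case (Suc r)
  then show ?case by (auto simp: index_word_Suc)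
qed (simp add: index_word_def)

text \<open>The two words have the same letters in different order; \<open>z_word_perm\<close> turns
  this into equality up to a factor from K.\<close>

lemma mset_concat_replicate_index_word:
  "mset (concat (replicate q (index_word r m))) = mset (index_word r (\<lambda>i. q * m i))"
proof (rule multiset_eqI)
  fix i :: nat
  have "count (mset (concat (replicate q w))) i = q * count (mset w) i" for w :: "nat list"
    by (induction q) simp_all
  then show "count (mset (concat (replicate q (index_word r m)))) i
      = count (mset (index_word r (\<lambda>i. q * m i))) i"
    by (simp add: count_index_word)
qed

lemma prod_list_map_concat_replicate:
  "prod_list (map z (concat (replicate q w))) = prod_list (map z w) ^ q"
  by (induction q) simp_all

text \<open>Commutativity makes the ordered composition a product over an index set, the form to
  which \<open>group_basis\<close> applies.\<close>

lemma aut_power_finprod: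
  assumes "comm_group (gal i)" "\<And>n. n < r \<Longrightarrow> \<sigma> n \<in> carrier (gal i)"
  shows "aut_power r \<sigma> m = finprod (gal i) (\<lambda>n. \<sigma> n [^]\<^bsub>gal i\<^esub> m n) {..<r}"
proof -
  interpret G: comm_group "gal i" by fact
  show ?thesis using assms(2)
  proof (induction r)
    case (Suc r)
    have "finprod (gal i) (\<lambda>n. \<sigma> n [^]\<^bsub>gal i\<^esub> m n) {..<Suc r}
        = \<sigma> r [^]\<^bsub>gal i\<^esub> m r \<otimes>\<^bsub>gal i\<^esub> aut_power r \<sigma> m"
      using Suc by (simp add: lessThan_Suc Pi_def)
    also have "\<dots> = aut_power r \<sigma> m \<otimes>\<^bsub>gal i\<^esub> \<sigma> r [^]\<^bsub>gal i\<^esub> m r"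
      using Suc by (intro G.m_comm) (auto simp: Pi_def)
    finally show ?case by (simp add: aut_power_Suc gal_simps gal_pow)
  qed (simp add: gal_simps)
qed

lemma (in comm_group) finprod_nat_pow:
  assumes "f \<in> A \<rightarrow> carrier G"
  shows "finprod G f A [^] (n::nat) = finprod G (\<lambda>a. f a [^] n) A"
proof (induction n)
  case (Suc n)
  have "(\<lambda>a. f a [^] n) \<in> A \<rightarrow> carrier G" using assms by auto
  then show ?case using Suc assms by simp
qed simp

text \<open>The tuple of powers and the trivial tuple have the same product, so injectivity of the
  product map makes each power trivial.\<close>

lemma group_basis_ord_dvd:
  assumes basis: "group_basis G r x" and one: "finprod G (\<lambda>n. x n [^]\<^bsub>G\<^esub> m n) {..<r} = \<one>\<^bsub>G\<^esub>"
    and "n < r"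
  shows "group.ord G (x n) dvd (m n :: nat)"
proof -
  interpret G: comm_group G using basis by (simp add: group_basis_def)
  have x: "x n \<in> carrier G" if "n < r" for n using basis that by (simp add: group_basis_def)
  let ?P = "product_group {..<r} (\<lambda>n. subgroup_generated G {x n})"
  let ?f = "\<lambda>g. finprod G g {..<r}"
  have inj: "inj_on ?f (carrier ?P)"
    using basis by (simp add: group_basis_def iso_def bij_betw_def)
  have pow: "x n [^]\<^bsub>G\<^esub> (k::nat) \<in> carrier (subgroup_generated G {x n})" if "n < r" for n k
    using x[OF that] by (auto simp: G.carrier_subgroup_generated_by_singleton int_pow_int[symmetric])
  \<comment> \<open>Restricted to the index set, since elements of the product group are extensional
    functions.\<close>
  let ?g = "\<lambda>n\<in>{..<r}. x n [^]\<^bsub>G\<^esub> m n" and ?h = "\<lambda>n\<in>{..<r}. \<one>\<^bsub>G\<^esub>"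
  have "?f ?g = ?f (\<lambda>n. x n [^]\<^bsub>G\<^esub> m n)" using x by (intro G.finprod_cong') auto
  also have "\<dots> = \<one>\<^bsub>G\<^esub>" by (rule one)
  also have "\<dots> = ?f ?h" by (rule sym, rule G.finprod_one_eqI) simp
  finally have "?f ?g = ?f ?h" .
  moreover have "?g \<in> carrier ?P" using pow by auto
  moreover have "?h \<in> carrier ?P" using pow[of _ 0] by auto
  ultimately have "?g = ?h" using inj by (rule_tac inj_onD)
  then have "?g n = ?h n" by simp
  then show ?thesis using \<open>n < r\<close> x G.pow_eq_id by simp
qed

section \<open>Commutation and powers of the crossed product generators\<close>

context abelian_crossed_product
begin

interpretation \<kappa>: inj_ring_hom \<kappa> by (rule embedding)

lemma gal_comm_group: "comm_group (gal iK)"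
  using basis by (simp add: group_basis_def)

lemma sigma_in_gal: "i < r \<Longrightarrow> \<sigma> i \<in> carrier (gal iK)"
  using basis by (simp add: group_basis_def)

lemma word_aut_in_gal: "set w \<subseteq> {..<r} \<Longrightarrow> word_aut \<sigma> w \<in> carrier (gal iK)"
proof (induction w)
  case Nil
  then show ?case using group.is_monoid[OF gal_group, THEN monoid.one_closed, of iK]
    by (simp add: gal_simps id_def)
next
  case (Cons i w)
  then show ?case
    using group.is_monoid[OF gal_group, THEN monoid.m_closed, of "\<sigma> i" iK "word_aut \<sigma> w"] sigma_in_gal
    by (simp add: gal_simps comp_def)
qed

lemma aut_power_in_gal: "aut_power r \<sigma> m \<in> carrier (gal iK)"
  by (simp add: aut_power_word word_aut_in_gal[OF set_index_word])

lemma sigma_hom: "i < r \<Longrightarrow> field_hom (\<sigma> i)"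
  using gal_memD sigma_in_gal by blast

lemma sigma_eq_0_iff: "i < r \<Longrightarrow> \<sigma> i k = 0 \<longleftrightarrow> k = 0"
proof -
  assume "i < r"
  then interpret field_hom "\<sigma> i" by (rule sigma_hom)
  show ?thesis by simp
qed

lemma u_letter_word_nonzero:
  "i < r \<Longrightarrow> set w \<subseteq> {..<r} \<Longrightarrow> u_letter_word \<sigma> u i w \<noteq> 0"
  by (induction w) (auto simp: u_nonzero sigma_eq_0_iff)

lemma u_word_nonzero:
  "set v \<subseteq> {..<r} \<Longrightarrow> set w \<subseteq> {..<r} \<Longrightarrow> u_word \<sigma> u v w \<noteq> 0"
  by (induction v) (auto simp: u_letter_word_nonzero sigma_eq_0_iff)

lemma z_word_move:
  "set w \<subseteq> {..<r} \<Longrightarrow> prod_list (map z w) * \<kappa> k = \<kappa> (word_aut \<sigma> w k) * prod_list (map z w)"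
proof (induction w)
  case (Cons i w)
  then have "z i * prod_list (map z w) * \<kappa> k = z i * \<kappa> (word_aut \<sigma> w k) * prod_list (map z w)"
    by (simp add: mult.assoc)
  also have "z i * \<kappa> (word_aut \<sigma> w k) = \<kappa> (\<sigma> i (word_aut \<sigma> w k)) * z i"
    using Cons.prems by (intro z_move) simp
  finally show ?case by (simp add: mult.assoc)
qed simp

lemma z_word_unit: "set w \<subseteq> {..<r} \<Longrightarrow> ring_unit (prod_list (map z w))"
  using z_unit by (intro ring_unit_prod_list) auto

text \<open>The generators commute up to factors from K, and such factors move left past generators,
  changing by automorphisms and staying nonzero.\<close>

lemma z_word_perm:
  assumes "mset v = mset w" "set w \<subseteq> {..<r}"
  shows "\<exists>c. c \<noteq> 0 \<and> prod_list (map z v) = \<kappa> c * prod_list (map z w)"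
  using assms
proof (induction v arbitrary: w)
  case Nil
  then show ?case by (intro exI[of _ 1]) simp
next
  case (Cons i v)
  have "i \<in> set w" using Cons.prems(1) by (metis list.set_intros(1) set_mset_mset)
  then obtain xs ys where w: "w = xs @ i # ys" by (meson split_list)
  have "mset v = mset (xs @ ys)" using Cons.prems(1) by (simp add: w)
  moreover have sets: "set (xs @ ys) \<subseteq> {..<r}" and i: "i < r" and xs: "set xs \<subseteq> {..<r}"
    using Cons.prems(2) by (auto simp: w)
  ultimately obtain c where c: "c \<noteq> 0" "prod_list (map z v) = \<kappa> c * prod_list (map z (xs @ ys))"
    using Cons.IH by blast
  let ?xs = "prod_list (map z xs)" and ?ys = "prod_list (map z ys)" and ?l = "u_letter_word \<sigma> u i xs"
  \<comment> \<open>The leading letter travels past \<open>xs\<close> to its position in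
    \<open>w\<close>, which costs the factor \<open>?l\<close>.\<close>
  have "z i * prod_list (map z v) = (z i * \<kappa> c) * (?xs * ?ys)" by (simp add: c mult.assoc)
  also have "\<dots> = \<kappa> (\<sigma> i c) * ((z i * ?xs) * ?ys)" by (simp add: z_move[OF i] mult.assoc)
  also have "\<dots> = \<kappa> (\<sigma> i c * ?l) * (?xs * z i * ?ys)"
    by (simp add: z_letter_word[OF i xs] \<kappa>.hom_mult mult.assoc)
  finally have "prod_list (map z (i # v)) = \<kappa> (\<sigma> i c * ?l) * prod_list (map z w)"
    by (simp add: w mult.assoc)
  moreover have "\<sigma> i c * ?l \<noteq> 0"
    using c(1) i xs by (simp add: sigma_eq_0_iff u_letter_word_nonzero)
  ultimately show ?case by blast
qed

text \<open>The power \<open>(z\<^sup>n)\<^sup>q\<close> agrees with \<open>z\<^bsup>qn\<^esup>\<close> up to a factor from \<open>K\<^sup>*\<close>, and \<open>ord \<sigma>\<^sub>i\<close> divides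
  \<open>q n\<^sub>i\<close> for all \<open>i\<close> because the \<open>\<sigma>\<^sub>i\<close> form a basis.\<close>

lemma z_power_in_K:
  assumes "(aut_power r \<sigma> n) [^]\<^bsub>gal iK\<^esub> q = \<one>\<^bsub>gal iK\<^esub>"
  obtains B where "B \<noteq> 0" "ring_power r z n ^ q = \<kappa> B"
proof -
  interpret G: comm_group "gal iK" by (rule gal_comm_group)
  have "\<one>\<^bsub>gal iK\<^esub> = finprod (gal iK) (\<lambda>i. \<sigma> i [^]\<^bsub>gal iK\<^esub> n i) {..<r} [^]\<^bsub>gal iK\<^esub> q"
    using assms by (simp add: aut_power_finprod[OF gal_comm_group sigma_in_gal])
  also have "\<dots> = finprod (gal iK) (\<lambda>i. (\<sigma> i [^]\<^bsub>gal iK\<^esub> n i) [^]\<^bsub>gal iK\<^esub> q) {..<r}"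
    using sigma_in_gal by (intro G.finprod_nat_pow) auto
  also have "\<dots> = finprod (gal iK) (\<lambda>i. \<sigma> i [^]\<^bsub>gal iK\<^esub> (q * n i)) {..<r}"
    using sigma_in_gal by (intro G.finprod_cong') (auto simp: G.nat_pow_pow mult.commute)
  finally have dvd: "group.ord (gal iK) (\<sigma> i) dvd q * n i" if "i < r" for i
    using group_basis_ord_dvd[OF basis _ that, of "\<lambda>i. q * n i"] by simp
  have "\<exists>a. a \<noteq> 0 \<and> z i ^ (q * n i) = \<kappa> a" if i: "i < r" for i
  proof -
    obtain k where "q * n i = group.ord (gal iK) (\<sigma> i) * k" using dvd[OF i] by (elim dvdE)
    then have "z i ^ (q * n i) = \<kappa> (b i ^ k)"
      using i by (simp add: power_mult b_eq \<kappa>.hom_power)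
    then show ?thesis using b_nonzero[OF i] by (intro exI[of _ "b i ^ k"]) simp
  qed
  then obtain a where a: "\<And>i. i < r \<Longrightarrow> a i \<noteq> 0" "\<And>i. i < r \<Longrightarrow> z i ^ (q * n i) = \<kappa> (a i)"
    by metis
  have "ring_power r z (\<lambda>i. q * n i) = prod_list (map (\<lambda>i. \<kappa> (a i)) [0..<r])"
    unfolding ring_power_def using a(2) by (intro arg_cong[of _ _ prod_list] map_cong) auto
  also have "\<dots> = \<kappa> (prod_list (map a [0..<r]))"
    by (simp add: \<kappa>.hom_prod_list comp_def)
  finally have "ring_power r z (\<lambda>i. q * n i) = \<kappa> (prod_list (map a [0..<r]))" .
  moreover obtain c where "c \<noteq> 0"
    "ring_power r z n ^ q = \<kappa> c * ring_power r z (\<lambda>i. q * n i)"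
    using z_word_perm[OF mset_concat_replicate_index_word set_index_word, of q n]
    by (auto simp: ring_power_word prod_list_map_concat_replicate)
  ultimately show ?thesis
    using a(1) by (intro that[of "c * prod_list (map a [0..<r])"]) (auto simp: \<kappa>.hom_mult)
qed

text \<open>Moving \<open>ring_power r z m\<close> past \<open>\<kappa> B\<close> gives
  \<open>\<tau> B\<close>. Moving it past the \<open>q\<close> factors one at a time gives a product
  of \<open>\<rho>\<close>-conjugates of \<open>u_multi r \<sigma> u m n\<close>, which is its
  \<open>q\<close>-th power up to a quotient \<open>\<rho> c / c\<close>.\<close>

lemma u_multi_power:
  fixes m n
  assumes B: "B \<noteq> 0" "ring_power r z n ^ q = \<kappa> B"
  defines "\<tau> \<equiv> aut_power r \<sigma> m" and "\<rho> \<equiv> aut_power r \<sigma> n"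
  obtains c where "c \<noteq> 0" "u_multi r \<sigma> u m n ^ q = \<tau> B / B * (\<rho> c / c)"
proof -
  let ?W = "ring_power r z m" and ?V = "ring_power r z n" and ?u = "u_multi r \<sigma> u m n"
  interpret \<rho>: field_hom \<rho> unfolding \<rho>_def using gal_memD aut_power_in_gal by blast
  have u: "?u \<noteq> 0" unfolding u_multi_def by (intro u_word_nonzero set_index_word)
  have WV: "?W * ?V = \<kappa> ?u * (?V * ?W)"
    unfolding ring_power_word u_multi_def by (rule z_word[OF set_index_word set_index_word])
  have V: "?V * \<kappa> k = \<kappa> (\<rho> k) * ?V" for k
    unfolding ring_power_word \<rho>_def aut_power_word by (rule z_word_move[OF set_index_word])
  have W: "?W * \<kappa> k = \<kappa> (\<tau> k) * ?W" for k
    unfolding ring_power_word \<tau>_def aut_power_word by (rule z_word_move[OF set_index_word])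
  \<comment> \<open>Each further factor applies \<open>\<rho>\<close> to the coefficient collected
    so far; replacing \<open>c\<close> by \<open>?u ^ j * \<rho> c\<close> restores the
    form.\<close>
  have "\<exists>c. c \<noteq> 0 \<and> ?W * ?V ^ j = \<kappa> (?u ^ j * (\<rho> c / c)) * (?V ^ j * ?W)" for j
  proof (induction j)
    case 0
    then show ?case by (intro exI[of _ 1]) simp
  next
    case (Suc j)
    then obtain c where c: "c \<noteq> 0" "?W * ?V ^ j = \<kappa> (?u ^ j * (\<rho> c / c)) * (?V ^ j * ?W)" by blast
    let ?a = "?u ^ j * (\<rho> c / c)" and ?c = "?u ^ j * \<rho> c"
    have "?W * ?V ^ Suc j = (?W * ?V) * ?V ^ j" by (simp add: mult.assoc)
    also have "\<dots> = \<kappa> ?u * (?V * (?W * ?V ^ j))" by (simp only: WV mult.assoc)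
    also have "\<dots> = \<kappa> ?u * ((?V * \<kappa> ?a) * (?V ^ j * ?W))" by (simp only: c mult.assoc)
    also have "\<dots> = \<kappa> (?u * \<rho> ?a) * (?V ^ Suc j * ?W)"
      unfolding V by (simp only: \<kappa>.hom_mult[of ?u] mult.assoc power_Suc)
    also have "?u * \<rho> ?a = ?u ^ Suc j * (\<rho> ?c / ?c)"
      using u c(1) by (simp add: \<rho>.hom_mult \<rho>.hom_power \<rho>.hom_div)
    finally show ?case using u c(1) by (intro exI[of _ ?c]) simp
  qed
  then obtain c where c: "c \<noteq> 0" "?W * ?V ^ q = \<kappa> (?u ^ q * (\<rho> c / c)) * (?V ^ q * ?W)" by blast
  have unit: "ring_unit ?W" unfolding ring_power_word by (rule z_word_unit[OF set_index_word])
  have "\<kappa> (\<tau> B) * ?W = \<kappa> (?u ^ q * (\<rho> c / c) * B) * ?W"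
    using c(2) by (simp only: B(2) W \<kappa>.hom_mult mult.assoc)
  then have "\<kappa> (\<tau> B) * ?W * ring_inv ?W = \<kappa> (?u ^ q * (\<rho> c / c) * B) * ?W * ring_inv ?W" by simp
  then have "\<kappa> (\<tau> B) = \<kappa> (?u ^ q * (\<rho> c / c) * B)"
    by (simp only: mult.assoc ring_unit_inv[OF unit] mult_1_right)
  then have eq: "\<tau> B = ?u ^ q * (\<rho> c / c) * B" using \<kappa>.injectivity by blast
  \<comment> \<open>The quotient changes sides, so the witness is the inverse of
    \<open>c\<close>.\<close>
  have "?u ^ q = \<tau> B / B * (\<rho> (inverse c) / inverse c)"
    using B(1) c(1) unfolding eq \<rho>.hom_inverse by (simp add: field_simps)
  then show ?thesis using c(1) by (intro that[of "inverse c"]) auto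
qed

end

section \<open>Descent of degeneracy\<close>

lemma u_letter_word_transfer:
  assumes "field_hom j" "\<And>i k. i < r \<Longrightarrow> \<rho> i (j k) = j (\<sigma> i k)" "set w \<subseteq> {..<r}"
  shows "u_letter_word \<rho> (\<lambda>i n. j (u i n)) i w = j (u_letter_word \<sigma> u i w)"
proof -
  interpret j: field_hom j by fact
  show ?thesis using assms(3) by (induction w) (auto simp: j.hom_mult assms(2))
qed

text \<open>\<open>u_multi\<close> is built from \<open>u\<close> and the action alone, so an
  embedding that intertwines the actions respects it.\<close>

lemma u_multi_transfer:
  assumes "field_hom j" "\<And>i k. i < r \<Longrightarrow> \<rho> i (j k) = j (\<sigma> i k)"
  shows "u_multi r \<rho> (\<lambda>i n. j (u i n)) m n = j (u_multi r \<sigma> u m n)"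
proof -
  interpret j: field_hom j by fact
  have "u_word \<rho> (\<lambda>i n. j (u i n)) v w = j (u_word \<sigma> u v w)"
    if v: "set v \<subseteq> {..<r}" and w: "set w \<subseteq> {..<r}" for v w
  proof -
    have "u_letter_word \<rho> (\<lambda>i n. j (u i n)) i w = j (u_letter_word \<sigma> u i w)" for i
      by (rule u_letter_word_transfer[OF assms(1) _ w]) (rule assms(2))
    then show ?thesis using v by (induction v) (auto simp: j.hom_mult assms(2))
  qed
  then show ?thesis unfolding u_multi_def by (simp add: set_index_word)
qed

lemma aut_power_unit_index: "i < r \<Longrightarrow> aut_power r \<sigma> (unit_index i) = \<sigma> i"
proof -
  have "aut_power k \<sigma> (unit_index i) = (if i < k then \<sigma> i else id)" for k
    by (induction k) (auto simp: aut_power_Suc unit_index_def less_Suc_eq)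
  then show "i < r \<Longrightarrow> ?thesis" by simp
qed

lemma (in group_hom) ord_image:
  assumes "inj_on h (carrier G)" "x \<in> carrier G"
  shows "H.ord (h x) = G.ord x"
proof -
  have "h x [^]\<^bsub>H\<^esub> n = \<one>\<^bsub>H\<^esub> \<longleftrightarrow> x [^]\<^bsub>G\<^esub> n = \<one>\<^bsub>G\<^esub>" for n :: nat
    using assms inj_on_eq_iff[OF assms(1), of "x [^]\<^bsub>G\<^esub> n" "\<one>\<^bsub>G\<^esub>"] by (simp add: hom_nat_pow)
  then show ?thesis
    using G.pow_eq_id[OF assms(2)] H.pow_eq_id[of "h x"] assms(2) by (metis dvd_antisym dvd_refl hom_closed)
qed

text \<open>Used contrapositively: if the lifted automorphisms generate a noncyclic group, so do the
  original ones.\<close>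

lemma (in group_hom) cyclic_image:
  assumes "S \<subseteq> carrier G" "cyclic_group (subgroup_generated G S)"
  shows "cyclic_group (subgroup_generated H (h ` S))"
proof (rule group.cyclic_group_epimorphic_image[OF _ _ assms(2)])
  have "carrier (subgroup_generated G S) \<subseteq> carrier G" by (rule G.carrier_subgroup_generated_subset)
  then show "h \<in> epi (subgroup_generated G S) (subgroup_generated H (h ` S))"
    using subgroup_generated_by_image[OF assms(1)] by (auto simp: epi_def hom_def intro!: hom_mult)
qed simp_all

text \<open>By the relation between the exponents, \<open>x\<close> is the quotient of
  \<open>x ^ (q * s)\<close> by \<open>x ^ (d * t)\<close>. The form of the right-hand sides is
  stable under powers and quotients.\<close>

lemma combine_powers:
  assumes "field_hom \<tau>" "field_hom \<rho>"
    and nz: "B \<noteq> 0" "c \<noteq> 0" "a \<noteq> 0" "y \<noteq> 0"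
    and q: "x ^ q = \<tau> B / B * (\<rho> c / c)" and d: "x ^ d = \<tau> a / a * (\<rho> y / y)"
    and st: "q * s = d * t + 1"
  shows "x = \<tau> (B ^ s / a ^ t) / (B ^ s / a ^ t) * (\<rho> (c ^ s / y ^ t) / (c ^ s / y ^ t))"
proof -
  interpret \<tau>: field_hom \<tau> by fact
  interpret \<rho>: field_hom \<rho> by fact
  have "x ^ d \<noteq> 0" unfolding d using nz by simp
  then have "x = x ^ (q * s) / x ^ (d * t)"
    unfolding st by (simp add: power_mult)
  also have "\<dots> = (x ^ q) ^ s / (x ^ d) ^ t" by (simp only: power_mult)
  finally show ?thesis
    unfolding q d using nz
    by (simp add: \<tau>.hom_div \<tau>.hom_power \<rho>.hom_div \<rho>.hom_power power_mult_distrib power_divide)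
      (simp add: mult_ac)
qed

locale coprime_composite =
  abelian_crossed_product iK \<kappa> r \<sigma> z u b + disjoint_composite iK iE jK jE d e
  for iK :: "'f::field \<Rightarrow> 'k::field" and \<kappa> :: "'k \<Rightarrow> 'd::ring_1" and r \<sigma> z u b
    and iE :: "'f \<Rightarrow> 'e::field" and jK :: "'k \<Rightarrow> 'l::field" and jE :: "'e \<Rightarrow> 'l" and d e +
  assumes coprime: "coprime (Coset.order (gal iK)) d"
    and finite_gal: "finite (carrier (gal iK))"
begin

abbreviation \<sigma>\<^sub>L :: "nat \<Rightarrow> 'l \<Rightarrow> 'l" where
  "\<sigma>\<^sub>L \<equiv> \<lambda>i. gal_lift jK jE (\<sigma> i)"

lemma gal_lift_sigma: "i < r \<Longrightarrow> \<sigma>\<^sub>L i = lift (\<sigma> i)"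
  by (simp add: gal_lift_eq sigma_in_gal)

lemma group_hom_lift: "group_hom (gal iK) (gal jE) lift"
  by (simp add: group_hom_def group_hom_axioms_def gal_group lift_hom)

lemma aut_power_lift: "aut_power r \<sigma>\<^sub>L m = lift (aut_power r \<sigma> m)"
proof -
  interpret lift: group_hom "gal iK" "gal jE" lift by (rule group_hom_lift)
  \<comment> \<open>The bound keeps the induction to indices where \<open>\<sigma> i\<close> is
    known to lie in the Galois group, so that \<open>gal_lift\<close> agrees with
    \<open>lift\<close>.\<close>
  have "k \<le> r \<Longrightarrow> aut_power k \<sigma> m \<in> carrier (gal iK) \<and> aut_power k \<sigma>\<^sub>L m = lift (aut_power k \<sigma> m)" for k
  proof (induction k)
    case 0
    then show ?case using lift.hom_one lift.G.one_closed by (simp add: gal_simps id_def)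
  next
    case (Suc k)
    have pow: "\<sigma> k ^^ m k \<in> carrier (gal iK)" "lift (\<sigma> k) ^^ m k = lift (\<sigma> k ^^ m k)"
      using lift.hom_nat_pow[of "\<sigma> k" "m k"] lift.G.nat_pow_closed[of "\<sigma> k" "m k"] sigma_in_gal[of k] Suc.prems
      by (simp_all add: gal_pow)
    then show ?case
      using Suc lift.hom_mult[of "aut_power k \<sigma> m" "\<sigma> k ^^ m k"]
        lift.G.m_closed[of "aut_power k \<sigma> m" "\<sigma> k ^^ m k"]
      by (simp add: aut_power_Suc gal_lift_sigma gal_simps comp_def)
  qed
  then show ?thesis by simp
qed

lemma u_multi_lift: "u_multi r \<sigma>\<^sub>L (\<lambda>i j. jK (u i j)) m n = jK (u_multi r \<sigma> u m n)"
  using lift_jK sigma_in_gal by (intro u_multi_transfer hom_jK) (auto simp: gal_lift_sigma)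

text \<open>The norm sends \<open>jK x\<close> to \<open>x ^ d\<close> and commutes with lifts;
  clearing denominators first avoids norms of quotients.\<close>

lemma norm_form:
  assumes "\<tau> \<in> carrier (gal iK)" "\<rho> \<in> carrier (gal iK)" "a \<noteq> 0" "y \<noteq> 0"
    and x: "jK x = lift \<tau> a / a * (lift \<rho> y / y)"
  shows "x ^ d = \<tau> (norm_K a) / norm_K a * (\<rho> (norm_K y) / norm_K y)"
proof -
  have "jK x * a * y = lift \<tau> a * lift \<rho> y" using assms by (simp add: field_simps)
  then have "x ^ d * norm_K a * norm_K y = \<tau> (norm_K a) * \<rho> (norm_K y)"
    using assms(1,2) by (metis norm_jK norm_lift norm_mult)
  then show ?thesis using norm_nonzero assms(3,4) by (simp add: field_simps)
qed

text \<open>The order of \<open>\<tau>\<close> divides the group order, hence is prime to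
  \<open>d\<close>. Finiteness makes it nonzero, so the Bezout relation holds in natural numbers
  with this sign.\<close>

lemma bezout_ord:
  assumes "\<tau> \<in> carrier (gal iK)"
  obtains s t where "group.ord (gal iK) \<tau> * s = d * t + 1"
proof -
  interpret G: group "gal iK" by (rule gal_group)
  have "G.ord \<tau> dvd Coset.order (gal iK)" by (rule G.ord_dvd_group_order[OF assms])
  then have "coprime (G.ord \<tau>) d" using coprime by (rule coprime_divisors[OF _ dvd_refl])
  moreover have "G.ord \<tau> \<noteq> 0" using G.ord_ge_1[OF finite_gal assms] by simp
  ultimately show ?thesis using bezout_nat[of "G.ord \<tau>" d] that by auto
qed

text \<open>\<open>B\<close> comes from a power of \<open>ring_power r z n\<close> and is chosen
  before \<open>m\<close>: strong degeneracy needs one \<open>B\<close> for all generators.\<close>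

lemma crossed_power:
  obtains B where "B \<noteq> 0"
    "\<And>m. \<exists>c. c \<noteq> 0 \<and> u_multi r \<sigma> u m n ^ group.ord (gal iK) (aut_power r \<sigma> n)
       = aut_power r \<sigma> m B / B * (aut_power r \<sigma> n c / c)"
proof -
  interpret G: group "gal iK" by (rule gal_group)
  obtain B where B: "B \<noteq> 0" "ring_power r z n ^ G.ord (aut_power r \<sigma> n) = \<kappa> B"
    using z_power_in_K[OF G.pow_ord_eq_1[OF aut_power_in_gal]] by blast
  show ?thesis using u_multi_power[OF B] by (intro that[OF B(1)]) metis
qed

text \<open>The norm supplies the relation with exponent \<open>d\<close>, the crossed product the
  one whose exponent is the order of an automorphism; coprimality combines them.\<close>

lemma degenerate_descends:
  assumes "degenerate jE r \<sigma>\<^sub>L (\<lambda>i j. jK (u i j))"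
  shows "degenerate iK r \<sigma> u"
proof -
  interpret lift: group_hom "gal iK" "gal jE" lift by (rule group_hom_lift)
  obtain m n a y where "a \<noteq> 0" "y \<noteq> 0"
    and noncyclic: "\<not> cyclic_group (subgroup_generated (gal jE) {lift (aut_power r \<sigma> m), lift (aut_power r \<sigma> n)})"
    and eq: "jK (u_multi r \<sigma> u m n)
      = lift (aut_power r \<sigma> m) a * inverse a * lift (aut_power r \<sigma> n) y * inverse y"
    using assms unfolding degenerate_def aut_power_lift u_multi_lift by blast
  let ?\<tau> = "aut_power r \<sigma> m" and ?\<rho> = "aut_power r \<sigma> n"
  have \<tau>: "?\<tau> \<in> carrier (gal iK)" and \<rho>: "?\<rho> \<in> carrier (gal iK)" by (rule aut_power_in_gal)+
  have "u_multi r \<sigma> u m n ^ d = ?\<tau> (norm_K a) / norm_K a * (?\<rho> (norm_K y) / norm_K y)"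
    using eq by (intro norm_form[OF \<tau> \<rho> \<open>a \<noteq> 0\<close> \<open>y \<noteq> 0\<close>]) (simp add: divide_inverse mult.assoc)
  moreover obtain B c where "B \<noteq> 0" "c \<noteq> 0"
    "u_multi r \<sigma> u m n ^ lift.G.ord ?\<rho> = ?\<tau> B / B * (?\<rho> c / c)"
    using crossed_power[of n] by metis
  moreover obtain s t where "lift.G.ord ?\<rho> * s = d * t + 1" using bezout_ord[OF \<rho>] .
  ultimately have "u_multi r \<sigma> u m n
      = ?\<tau> (B ^ s / norm_K a ^ t) / (B ^ s / norm_K a ^ t) * (?\<rho> (c ^ s / norm_K y ^ t) / (c ^ s / norm_K y ^ t))"
    using \<open>a \<noteq> 0\<close> \<open>y \<noteq> 0\<close> by (intro combine_powers gal_memD(2)[OF \<tau>] gal_memD(2)[OF \<rho>] norm_nonzero)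
  moreover have "\<not> cyclic_group (subgroup_generated (gal iK) {?\<tau>, ?\<rho>})"
    using lift.cyclic_image[of "{?\<tau>, ?\<rho>}"] \<tau> \<rho> noncyclic by auto
  moreover have "B ^ s / norm_K a ^ t \<noteq> 0" "c ^ s / norm_K y ^ t \<noteq> 0"
    using \<open>B \<noteq> 0\<close> \<open>c \<noteq> 0\<close> \<open>a \<noteq> 0\<close> \<open>y \<noteq> 0\<close> by (simp_all add: norm_nonzero)
  ultimately show ?thesis
    unfolding degenerate_def by (metis divide_inverse mult.assoc)
qed

text \<open>As for degeneracy, but the new \<open>l\<close> has to be the same for all
  \<open>i\<close>. It is, since the norm of \<open>l\<close>, the element \<open>B\<close> and the
  exponents \<open>s\<close>, \<open>t\<close> do not depend on \<open>i\<close>.\<close>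

lemma strongly_degenerate_descends:
  assumes "strongly_degenerate jE r \<sigma>\<^sub>L (\<lambda>i j. jK (u i j))"
  shows "strongly_degenerate iK r \<sigma> u"
proof -
  interpret lift: group_hom "gal iK" "gal jE" lift by (rule group_hom_lift)
  obtain m l y where prime: "Factorial_Ring.prime (lift.H.ord (lift (aut_power r \<sigma> m)))"
    and "l \<noteq> 0" and y: "\<And>i. i < r \<Longrightarrow> y i \<noteq> 0"
    and eq: "\<And>i. i < r \<Longrightarrow> jK (u_multi r \<sigma> u (unit_index i) m)
      = lift (aut_power r \<sigma> m) (y i) / y i * (l / lift (\<sigma> i) l)"
    using assms unfolding strongly_degenerate_def aut_power_lift u_multi_lift
    by (auto simp: gal_lift_sigma)
  let ?\<tau> = "aut_power r \<sigma> m" and ?u = "\<lambda>i. u_multi r \<sigma> u (unit_index i) m"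
  have \<tau>: "?\<tau> \<in> carrier (gal iK)" by (rule aut_power_in_gal)
  \<comment> \<open>The definition divides \<open>l\<close> by its conjugate, whereas
    \<open>norm_form\<close> divides the conjugate by the element; hence the inverse.\<close>
  define a where "a = norm_K (inverse l)"
  have "a \<noteq> 0" using \<open>l \<noteq> 0\<close> by (simp add: a_def norm_nonzero)
  have d: "?u i ^ d = \<sigma> i a / a * (?\<tau> (norm_K (y i)) / norm_K (y i))" if "i < r" for i
  proof -
    interpret lift_\<sigma>: field_hom "lift (\<sigma> i)"
      using gal_memD(2)[OF lift_in_gal[OF sigma_in_gal[OF that]]] .
    have "jK (?u i) = lift (\<sigma> i) (inverse l) / inverse l * (lift ?\<tau> (y i) / y i)"
      unfolding eq[OF that] lift_\<sigma>.hom_inverse by (simp add: divide_inverse mult_ac)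
    then show ?thesis
      unfolding a_def using y[OF that] \<open>l \<noteq> 0\<close> by (intro norm_form \<tau> sigma_in_gal that) auto
  qed
  obtain B where "B \<noteq> 0"
    and "\<And>n. \<exists>c. c \<noteq> 0 \<and> u_multi r \<sigma> u n m ^ lift.G.ord ?\<tau> = aut_power r \<sigma> n B / B * (?\<tau> c / c)"
    using crossed_power[of m] by blast
  then have "\<exists>c. c \<noteq> 0 \<and> ?u i ^ lift.G.ord ?\<tau> = \<sigma> i B / B * (?\<tau> c / c)" if "i < r" for i
    using that by (metis aut_power_unit_index)
  then obtain c where c: "\<And>i. i < r \<Longrightarrow> c i \<noteq> 0"
    "\<And>i. i < r \<Longrightarrow> ?u i ^ lift.G.ord ?\<tau> = \<sigma> i B / B * (?\<tau> (c i) / c i)"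
    by metis
  obtain s t where st: "lift.G.ord ?\<tau> * s = d * t + 1" using bezout_ord[OF \<tau>] .
  let ?l = "B ^ s / a ^ t" and ?y = "\<lambda>i. c i ^ s / norm_K (y i) ^ t"
  have form: "?u i = \<sigma> i ?l / ?l * (?\<tau> (?y i) / ?y i)" if "i < r" for i
    using that c \<open>B \<noteq> 0\<close> \<open>a \<noteq> 0\<close> y d st
    by (intro combine_powers sigma_hom gal_memD(2)[OF \<tau>] norm_nonzero) auto
  \<comment> \<open>Undoes the inversion of \<open>l\<close> to regain the shape of the
    definition.\<close>
  have "?u i = ?\<tau> (?y i) / ?y i * (inverse ?l / \<sigma> i (inverse ?l))" if "i < r" for i
  proof -
    interpret \<sigma>: field_hom "\<sigma> i" by (rule sigma_hom[OF that])
    have swap: "v / w * x = x * (inverse w / inverse v)" for v w x :: 'k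
      by (simp add: divide_inverse mult_ac)
    show ?thesis unfolding \<sigma>.hom_inverse by (rule trans[OF form[OF that] swap])
  qed
  moreover have "\<forall>i<r. ?y i \<noteq> 0" "inverse ?l \<noteq> 0"
    using c(1) y \<open>B \<noteq> 0\<close> \<open>a \<noteq> 0\<close> by (auto simp: norm_nonzero)
  moreover have "Factorial_Ring.prime (lift.G.ord ?\<tau>)"
    using prime lift.ord_image[OF lift_inj \<tau>] by simp
  ultimately show ?thesis
    unfolding strongly_degenerate_def by (intro exI[of _ m] exI[of _ "inverse ?l"] exI[of _ ?y]) blast
qed

end

theorem theorem1p13:
  fixes p r :: nat
    and iK :: "'f::field \<Rightarrow> 'k::field" and \<kappa> :: "'k \<Rightarrow> 'd::ring_1"
    and \<sigma> :: "nat \<Rightarrow> 'k \<Rightarrow> 'k" and z :: "nat \<Rightarrow> 'd"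
    and u :: "nat \<Rightarrow> nat \<Rightarrow> 'k" and b :: "nat \<Rightarrow> 'k"
    and iE :: "'f \<Rightarrow> 'e::field" and jK :: "'k \<Rightarrow> 'l::field" and jE :: "'e \<Rightarrow> 'l"
  assumes "Factorial_Ring.prime p"
    and "2 \<le> r"
    and "abelian_crossed_product iK \<kappa> r \<sigma> z u b"
    and "\<exists>k. Coset.order (gal iK) = p ^ k"
    and "finite_extension iE"
    and "coprime (dim_over iE) p"
    and "composite_field iK iE jK jE"
  shows "(\<not> strongly_degenerate iK r \<sigma> u \<longrightarrow>
            \<not> strongly_degenerate jE r (\<lambda>i. gal_lift jK jE (\<sigma> i)) (\<lambda>i j. jK (u i j))) \<and>
         (\<not> degenerate iK r \<sigma> u \<longrightarrow>
            \<not> degenerate jE r (\<lambda>i. gal_lift jK jE (\<sigma> i)) (\<lambda>i j. jK (u i j)))"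
proof -
  interpret abelian_crossed_product iK \<kappa> r \<sigma> z u b by fact
  obtain k where k: "Coset.order (gal iK) = p ^ k" using assms(4) by blast
  \<comment> \<open>An infinite carrier would have cardinality 0, so a positive order gives
    finiteness.\<close>
  have "p ^ k > 0" using prime_gt_0_nat[OF assms(1)] by simp
  then have "card (carrier (gal iK)) > 0" using k by (simp add: Coset.order_def)
  then have fin: "finite (carrier (gal iK))" by (rule card_ge_0_finite)
  have coprime: "coprime (Coset.order (gal iK)) (dim_over iE)"
    using assms(6) by (simp add: k coprime_commute)
  have "finite_extension iK" using galois by (simp add: galois_extension_def)
  \<comment> \<open>The degree of K/F equals the group order, a power of \<open>p\<close>, so it is
    prime to [E:F], as linear disjointness requires.\<close>
  then obtain e where "disjoint_composite iK iE jK jE (dim_over iE) e"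
    using disjoint_compositeI[OF assms(7) _ assms(5)] coprime
    unfolding galois_dim_eq_order[OF galois fin, symmetric] by blast
  then interpret coprime_composite iK \<kappa> r \<sigma> z u b iE jK jE "dim_over iE" e
    by (intro coprime_composite.intro coprime_composite_axioms.intro assms(3) coprime fin)
  show ?thesis using strongly_degenerate_descends degenerate_descends by blast
qed

end
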